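(* There is an algorithm that, on input a CNF formula $\phi$ over the variable set $V=\{x_1,\ldots,x_n\}$, halts in time linear in the length of $\phi$ and either returns that $\phi$ is not renamable partially Horn, or produces a subset $V^*\subseteq V$ such that the formula $\phi^*$ obtained from $\phi$ by renaming the variables in $V^*$ is partially Horn.
   Context: A clause is a disjunction of literals of pairwise distinct variables; a CNF formula is a conjunction of clauses. A Horn clause is a clause with at most one positive literal. Renaming a set $W$ of variables of a formula means replacing every occurrence of the literal $x$ by $\neg x$ and every occurrence of $\neg x$ by $x$, for every $x\in W$. A formula $\phi$ over $V$ is partially Horn if there is a non-empty subset $V_0\subseteq V$ such that (i) every clause containing only variables from $V_0$ is Horn, and (ii) the variables of $V_0$ appear only negatively (if at all) in every clause that also contains variables not in $V_0$. A formula is renamable partially Horn if some of its variables can be renamed so that it becomes partially Horn. *)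

theory Defs
  imports Main
begin

section \<open>CNF formulas\<close>

datatype 'v literal = Pos (var: 'v) | Neg (var: 'v)

type_synonym 'v clause = "'v literal list"
type_synonym 'v formula = "'v clause list"

definition clause_vars :: "'v clause \<Rightarrow> 'v set" where
  "clause_vars C = var ` set C"

definition cnf_over :: "'v set \<Rightarrow> 'v formula \<Rightarrow> bool" where
  "cnf_over V \<phi> \<longleftrightarrow> (\<forall>C \<in> set \<phi>. distinct (map var C) \<and> clause_vars C \<subseteq> V)"

definition horn :: "'v clause \<Rightarrow> bool" where
  "horn C \<longleftrightarrow> card {x. Pos x \<in> set C} \<le> 1"

fun rename_literal :: "'v set \<Rightarrow> 'v literal \<Rightarrow> 'v literal" where
  "rename_literal W (Pos x) = (if x \<in> W then Neg x else Pos x)"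
| "rename_literal W (Neg x) = (if x \<in> W then Pos x else Neg x)"

definition rename :: "'v set \<Rightarrow> 'v formula \<Rightarrow> 'v formula" where
  "rename W \<phi> = map (map (rename_literal W)) \<phi>"

definition partially_horn :: "'v set \<Rightarrow> 'v formula \<Rightarrow> bool" where
  "partially_horn V \<phi> \<longleftrightarrow>
     (\<exists>V0. V0 \<subseteq> V \<and> V0 \<noteq> {} \<and>
        (\<forall>C \<in> set \<phi>. clause_vars C \<subseteq> V0 \<longrightarrow> horn C) \<and>
        (\<forall>C \<in> set \<phi>. \<not> clause_vars C \<subseteq> V0 \<longrightarrow> (\<forall>x \<in> V0. Pos x \<notin> set C)))"

definition renamable_partially_horn :: "'v set \<Rightarrow> 'v formula \<Rightarrow> bool" where
  "renamable_partially_horn V \<phi> \<longleftrightarrow> (\<exists>W. W \<subseteq> V \<and> partially_horn V (rename W \<phi>))"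

text \<open>The length counts literal occurrences, plus one per clause so that reading an empty clause
  is not free. If all clauses are non-empty, this is at most twice the number of literal
  occurrences. The number of variables is deliberately not included.\<close>

definition formula_length :: "'v formula \<Rightarrow> nat" where
  "formula_length \<phi> = (\<Sum>C\<leftarrow>\<phi>. length C + 1)"


section \<open>Random access programs\<close>

text \<open>Structured programs for a successor RAM: scalar registers and arrays hold natural numbers,
  both are named by numbers occurring in the program text (so every program uses finitely many of
  them), and all instructions and tests have unit cost. The only arithmetic is successor and
  predecessor. Hence a run of t steps never produces a number exceeding t plus the maximum of the
  input numbers and the program constants, so the unit-cost measure cannot be abused by computing
  with very long numbers.\<close>

datatype test =
    Eq nat nat
  | Less nat nat

datatype prog =
    Skip
  | Const nat nat       \<comment> \<open>\<open>Const r k\<close>: \<open>r := k\<close>\<close>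
  | Copy nat nat        \<comment> \<open>\<open>Copy r s\<close>: \<open>r := s\<close>\<close>
  | Inc nat
  | Dec nat             \<comment> \<open>truncated at 0\<close>
  | Load nat nat nat    \<comment> \<open>\<open>Load r a s\<close>: \<open>r := a[s]\<close>\<close>
  | Store nat nat nat   \<comment> \<open>\<open>Store a s r\<close>: \<open>a[s] := r\<close>\<close>
  | Read nat            \<comment> \<open>next input number, or 0 when the input is exhausted\<close>
  | Write nat           \<comment> \<open>append to the output\<close>
  | Seq prog prog
  | If test prog prog
  | While test prog

record state =
  reg :: "nat \<Rightarrow> nat"
  arr :: "nat \<Rightarrow> nat \<Rightarrow> nat"
  inp :: "nat list"
  out :: "nat list"

fun holds :: "test \<Rightarrow> state \<Rightarrow> bool" where
  "holds (Eq r s) \<sigma> \<longleftrightarrow> reg \<sigma> r = reg \<sigma> s"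
| "holds (Less r s) \<sigma> \<longleftrightarrow> reg \<sigma> r < reg \<sigma> s"

definition set_reg :: "nat \<Rightarrow> nat \<Rightarrow> state \<Rightarrow> state" where
  "set_reg r v \<sigma> = \<sigma>\<lparr>reg := (reg \<sigma>)(r := v)\<rparr>"

definition set_arr :: "nat \<Rightarrow> nat \<Rightarrow> nat \<Rightarrow> state \<Rightarrow> state" where
  "set_arr a i v \<sigma> = \<sigma>\<lparr>arr := (arr \<sigma>)(a := (arr \<sigma> a)(i := v))\<rparr>"

text \<open>\<open>exec p \<sigma> t \<sigma>'\<close>: started in \<open>\<sigma>\<close>, the program \<open>p\<close> halts in \<open>\<sigma>'\<close> after exactly \<open>t\<close> steps.\<close>

inductive exec :: "prog \<Rightarrow> state \<Rightarrow> nat \<Rightarrow> state \<Rightarrow> bool" where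
  Skip: "exec Skip \<sigma> 1 \<sigma>"
| Const: "exec (Const r k) \<sigma> 1 (set_reg r k \<sigma>)"
| Copy: "exec (Copy r s) \<sigma> 1 (set_reg r (reg \<sigma> s) \<sigma>)"
| Inc: "exec (Inc r) \<sigma> 1 (set_reg r (reg \<sigma> r + 1) \<sigma>)"
| Dec: "exec (Dec r) \<sigma> 1 (set_reg r (reg \<sigma> r - 1) \<sigma>)"
| Load: "exec (Load r a s) \<sigma> 1 (set_reg r (arr \<sigma> a (reg \<sigma> s)) \<sigma>)"
| Store: "exec (Store a s r) \<sigma> 1 (set_arr a (reg \<sigma> s) (reg \<sigma> r) \<sigma>)"
| ReadNil: "inp \<sigma> = [] \<Longrightarrow> exec (Read r) \<sigma> 1 (set_reg r 0 \<sigma>)"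
| ReadCons: "inp \<sigma> = v # vs \<Longrightarrow> exec (Read r) \<sigma> 1 (set_reg r v \<sigma>\<lparr>inp := vs\<rparr>)"
| Write: "exec (Write r) \<sigma> 1 (\<sigma>\<lparr>out := out \<sigma> @ [reg \<sigma> r]\<rparr>)"
| Seq: "exec p \<sigma> t \<sigma>' \<Longrightarrow> exec q \<sigma>' u \<sigma>'' \<Longrightarrow> exec (Seq p q) \<sigma> (t + u) \<sigma>''"
| IfTrue: "holds b \<sigma> \<Longrightarrow> exec p \<sigma> t \<sigma>' \<Longrightarrow> exec (If b p q) \<sigma> (1 + t) \<sigma>'"
| IfFalse: "\<not> holds b \<sigma> \<Longrightarrow> exec q \<sigma> t \<sigma>' \<Longrightarrow> exec (If b p q) \<sigma> (1 + t) \<sigma>'"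
| WhileFalse: "\<not> holds b \<sigma> \<Longrightarrow> exec (While b p) \<sigma> 1 \<sigma>"
| WhileTrue: "holds b \<sigma> \<Longrightarrow> exec p \<sigma> t \<sigma>' \<Longrightarrow> exec (While b p) \<sigma>' u \<sigma>''
    \<Longrightarrow> exec (While b p) \<sigma> (1 + t + u) \<sigma>''"

lemma exec_deterministic:
  assumes "exec p \<sigma> t \<sigma>'" and "exec p \<sigma> u \<sigma>''"
  shows "t = u \<and> \<sigma>' = \<sigma>''"
  using assms
proof (induction arbitrary: u \<sigma>'' rule: exec.induct)
  case (Seq p \<sigma> t \<sigma>' q v \<sigma>2)
  from Seq.prems show ?case
    by (cases rule: exec.cases) (use Seq.IH in blast)+
next
  case (IfTrue b \<sigma> p t \<sigma>' q)
  from IfTrue.prems show ?case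
    by (cases rule: exec.cases) (use IfTrue in blast)+
next
  case (IfFalse b \<sigma> q t \<sigma>' p)
  from IfFalse.prems show ?case
    by (cases rule: exec.cases) (use IfFalse in blast)+
next
  case (WhileTrue b \<sigma> p t \<sigma>' v \<sigma>2)
  from WhileTrue.prems show ?case
    by (cases rule: exec.cases) (use WhileTrue in blast)+
qed (erule exec.cases; simp)+

definition initial :: "nat list \<Rightarrow> state" where
  "initial xs = \<lparr>reg = (\<lambda>_. 0), arr = (\<lambda>_ _. 0), inp = xs, out = []\<rparr>"

definition runs :: "prog \<Rightarrow> nat list \<Rightarrow> nat \<Rightarrow> nat list \<Rightarrow> bool" where
  "runs p xs t ys \<longleftrightarrow> (\<exists>\<sigma>. exec p (initial xs) t \<sigma> \<and> out \<sigma> = ys)"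


section \<open>Encoding of formulas\<close>

text \<open>The input consists of the number n of variables, the number of clauses, and each clause
  preceded by its number of literals. The variable \<open>x\<^sub>i\<close> is represented by the number i;
  a literal is its sign followed by its variable.\<close>

fun encode_literal :: "nat literal \<Rightarrow> nat list" where
  "encode_literal (Pos x) = [1, x]"
| "encode_literal (Neg x) = [0, x]"

definition encode_clause :: "nat clause \<Rightarrow> nat list" where
  "encode_clause C = length C # concat (map encode_literal C)"

definition encode_formula :: "nat \<Rightarrow> nat formula \<Rightarrow> nat list" where
  "encode_formula n \<phi> = n # length \<phi> # concat (map encode_clause \<phi>)"

end

theory Submission
  imports Defs
begin

text \<open>
  Draw an edge \<open>l \<rightarrow> \<not> l'\<close> for any two distinct literals \<open>l\<close>, \<open>l'\<close> of a common clause. A renaming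
  that makes the formula partially Horn corresponds to a non-empty consistent set of literals (those
  over \<open>V\<^sub>0\<close> that become positive) that is closed under these edges. The graph is skew symmetric, so
  the set \<open>R(l)\<close> of literals reachable from \<open>l\<close> is consistent unless it contains \<open>\<not> l\<close>.
  If some \<open>x \<in> R(l)\<close> has \<open>\<not> x \<notin> R(l)\<close>, then \<open>R(x)\<close> is consistent and solves the problem. If neither
  \<open>R(l)\<close> nor \<open>R(\<not> l)\<close> yields such an \<open>x\<close>, then they coincide and form an isolated component of
  unusable literals, which can be discarded; so every component is searched at most twice.

  Clauses induce quadratically many edges, but a search needs to scan each clause only once: when
  a second literal of the clause is reached, the only new successor is the complement of the literal
  through which the clause was entered first. Finally, the number of variables is not bounded by the
  length of the formula, but if it exceeds the number of literal occurrences, some variable does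
  not occur and nothing has to be renamed.
\<close>

section \<open>Weakest preconditions with running time\<close>

text \<open>The time bound is the obstacle: a search also scans occurrences of literals that it
  never reaches. Closure helps: if a clause contains a literal of \<open>R(l)\<close>, the
  complements of all its other literals lie in \<open>R(l)\<close>, so the whole clause lies over
  \<open>R(l)\<close> and its complements. A search is therefore paid for by the number of literals
  and occurrences of that symmetric set, its \<open>weight\<close>. When the searches from
  \<open>l\<close> and from its complement both fail, \<open>R(l)\<close> is itself symmetric, and
  no later search enters it: a path from a later start \<open>x\<close> into it would mirror to a
  path from it to the complement of \<open>x\<close>, so \<open>x\<close> would belong to it. Hence
  the failures are charged to pairwise disjoint sets, with the weight of everything discarded so far
  as potential, and the single success is charged to the set of all literals. This is also why a
  search need not look at the marks left by earlier failures.\<close>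

notation Seq (infixr ";;" 60)

fun written_regs :: "prog \<Rightarrow> nat set" where
  "written_regs (Const r k) = {r}"
| "written_regs (Copy r s) = {r}"
| "written_regs (Inc r) = {r}"
| "written_regs (Dec r) = {r}"
| "written_regs (Load r a s) = {r}"
| "written_regs (Read r) = {r}"
| "written_regs (p ;; q) = written_regs p \<union> written_regs q"
| "written_regs (If b p q) = written_regs p \<union> written_regs q"
| "written_regs (While b p) = written_regs p"
| "written_regs _ = {}"

fun written_arrs :: "prog \<Rightarrow> nat set" where
  "written_arrs (Store a s r) = {a}"
| "written_arrs (p ;; q) = written_arrs p \<union> written_arrs q"
| "written_arrs (If b p q) = written_arrs p \<union> written_arrs q"
| "written_arrs (While b p) = written_arrs p"
| "written_arrs _ = {}"

fun reads :: "prog \<Rightarrow> bool" where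
  "reads (Read r) \<longleftrightarrow> True"
| "reads (p ;; q) \<longleftrightarrow> reads p \<or> reads q"
| "reads (If b p q) \<longleftrightarrow> reads p \<or> reads q"
| "reads (While b p) \<longleftrightarrow> reads p"
| "reads _ \<longleftrightarrow> False"

fun writes :: "prog \<Rightarrow> bool" where
  "writes (Write r) \<longleftrightarrow> True"
| "writes (p ;; q) \<longleftrightarrow> writes p \<or> writes q"
| "writes (If b p q) \<longleftrightarrow> writes p \<or> writes q"
| "writes (While b p) \<longleftrightarrow> writes p"
| "writes _ \<longleftrightarrow> False"

lemma set_reg_simps [simp]:
  "reg (set_reg r v \<sigma>) = (reg \<sigma>)(r := v)"
  "arr (set_reg r v \<sigma>) = arr \<sigma>"
  "inp (set_reg r v \<sigma>) = inp \<sigma>"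
  "out (set_reg r v \<sigma>) = out \<sigma>"
  by (simp_all add: set_reg_def)

lemma set_arr_simps [simp]:
  "reg (set_arr a i v \<sigma>) = reg \<sigma>"
  "arr (set_arr a i v \<sigma>) b = (if b = a then (arr \<sigma> a)(i := v) else arr \<sigma> b)"
  "inp (set_arr a i v \<sigma>) = inp \<sigma>"
  "out (set_arr a i v \<sigma>) = out \<sigma>"
  by (simp_all add: set_arr_def)

text \<open>A syntactic bound on the effect of a program. The rules below supply it for free, so
  that postconditions and loop invariants mention only what changes.\<close>

definition frame :: "prog \<Rightarrow> state \<Rightarrow> state \<Rightarrow> bool" where
  "frame p \<sigma> \<sigma>' \<longleftrightarrow>
     (\<forall>r. r \<notin> written_regs p \<longrightarrow> reg \<sigma>' r = reg \<sigma> r) \<and>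
     (\<forall>a. a \<notin> written_arrs p \<longrightarrow> arr \<sigma>' a = arr \<sigma> a) \<and>
     (\<not> reads p \<longrightarrow> inp \<sigma>' = inp \<sigma>) \<and>
     (\<not> writes p \<longrightarrow> out \<sigma>' = out \<sigma>)"

lemma frame_refl: "frame p \<sigma> \<sigma>"
  by (simp add: frame_def)

lemma frame_trans: "frame p \<sigma> \<sigma>' \<Longrightarrow> frame p \<sigma>' \<sigma>'' \<Longrightarrow> frame p \<sigma> \<sigma>''"
  by (simp add: frame_def)

lemma exec_frame: "exec p \<sigma> t \<sigma>' \<Longrightarrow> frame p \<sigma> \<sigma>'"
  by (induction rule: exec.induct) (auto simp: frame_def)

text \<open>The second argument of a postcondition is the running time accumulated so far.\<close>

definition wp :: "prog \<Rightarrow> (state \<Rightarrow> nat \<Rightarrow> bool) \<Rightarrow> state \<Rightarrow> nat \<Rightarrow> bool" where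
  "wp p Q \<sigma> k \<longleftrightarrow> (\<exists>t \<sigma>'. exec p \<sigma> t \<sigma>' \<and> Q \<sigma>' (k + t))"

text \<open>Determinism turns the existential in \<open>wp\<close> into an equivalence, so
  straight-line code can be executed symbolically by rewriting.\<close>

lemma wp_exec: "exec p \<sigma> t \<sigma>' \<Longrightarrow> wp p Q \<sigma> k \<longleftrightarrow> Q \<sigma>' (k + t)"
  unfolding wp_def using exec_deterministic by blast

lemmas wp_basic [simp] =
  exec.Skip [THEN wp_exec] exec.Const [THEN wp_exec] exec.Copy [THEN wp_exec]
  exec.Inc [THEN wp_exec] exec.Dec [THEN wp_exec] exec.Load [THEN wp_exec]
  exec.Store [THEN wp_exec] exec.Write [THEN wp_exec]

lemma wp_Read [simp]:
  "wp (Read r) Q \<sigma> k \<longleftrightarrow> (case inp \<sigma> of [] \<Rightarrow> Q (set_reg r 0 \<sigma>) (k + 1)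
     | v # vs \<Rightarrow> Q (set_reg r v \<sigma>\<lparr>inp := vs\<rparr>) (k + 1))"
  by (auto simp: exec.ReadNil [THEN wp_exec] exec.ReadCons [THEN wp_exec] split: list.split)

inductive_cases exec_SeqE: "exec (p ;; q) \<sigma> t \<sigma>'"
inductive_cases exec_IfE: "exec (If b p q) \<sigma> t \<sigma>'"

lemma wp_Seq [simp]: "wp (p ;; q) Q \<sigma> k \<longleftrightarrow> wp p (wp q Q) \<sigma> k"
proof
  assume "wp (p ;; q) Q \<sigma> k"
  then obtain t \<sigma>' where "exec (p ;; q) \<sigma> t \<sigma>'" "Q \<sigma>' (k + t)"
    unfolding wp_def by blast
  then show "wp p (wp q Q) \<sigma> k"
    by (elim exec_SeqE) (auto simp: wp_exec add.assoc)
next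
  assume "wp p (wp q Q) \<sigma> k"
  then obtain t \<sigma>' u \<sigma>'' where "exec p \<sigma> t \<sigma>'" "exec q \<sigma>' u \<sigma>''" "Q \<sigma>'' (k + t + u)"
    unfolding wp_def by blast
  then show "wp (p ;; q) Q \<sigma> k"
    by (auto simp: wp_exec [OF exec.Seq] add.assoc)
qed

lemma wp_If [simp]:
  "wp (If b p q) Q \<sigma> k \<longleftrightarrow> (if holds b \<sigma> then wp p Q \<sigma> (k + 1) else wp q Q \<sigma> (k + 1))"
proof
  assume "wp (If b p q) Q \<sigma> k"
  then obtain t \<sigma>' where "exec (If b p q) \<sigma> t \<sigma>'" "Q \<sigma>' (k + t)"
    unfolding wp_def by blast
  then show "if holds b \<sigma> then wp p Q \<sigma> (k + 1) else wp q Q \<sigma> (k + 1)"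
    by (elim exec_IfE) (auto simp: wp_exec)
next
  assume "if holds b \<sigma> then wp p Q \<sigma> (k + 1) else wp q Q \<sigma> (k + 1)"
  then show "wp (If b p q) Q \<sigma> k"
    unfolding wp_def
    by (metis (full_types) exec.IfTrue exec.IfFalse add.assoc)
qed

lemma wp_conseq:
  assumes "wp p Q \<sigma> k" and "\<And>\<sigma>' k'. Q \<sigma>' k' \<Longrightarrow> frame p \<sigma> \<sigma>' \<Longrightarrow> Q' \<sigma>' k'"
  shows "wp p Q' \<sigma> k"
  using assms exec_frame unfolding wp_def by blast

text \<open>The measure \<open>m\<close> only ensures termination; the running time is bounded by
  \<open>I\<close>, which sees the accumulated steps. Frames are relative to the state before the
  loop, so \<open>I\<close> need not record what the body leaves alone.\<close>

lemma wp_While: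
  fixes m :: "state \<Rightarrow> nat"
  assumes "I \<sigma> k"
    and step: "\<And>\<sigma>' k'. I \<sigma>' k' \<Longrightarrow> frame p \<sigma> \<sigma>' \<Longrightarrow> holds b \<sigma>' \<Longrightarrow>
      wp p (\<lambda>\<sigma>'' k''. I \<sigma>'' k'' \<and> m \<sigma>'' < m \<sigma>') \<sigma>' (k' + 1)"
    and exit: "\<And>\<sigma>' k'. I \<sigma>' k' \<Longrightarrow> frame p \<sigma> \<sigma>' \<Longrightarrow> \<not> holds b \<sigma>' \<Longrightarrow> Q \<sigma>' (k' + 1)"
  shows "wp (While b p) Q \<sigma> k"
proof -
  have "wp (While b p) Q \<sigma>' k'" if "I \<sigma>' k'" "frame p \<sigma> \<sigma>'" for \<sigma>' k'
    using that
  proof (induction "m \<sigma>'" arbitrary: \<sigma>' k' rule: less_induct)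
    case less
    show ?case
    proof (cases "holds b \<sigma>'")
      case True
      then obtain t \<sigma>'' where t: "exec p \<sigma>' t \<sigma>''" "I \<sigma>'' (k' + 1 + t)" "m \<sigma>'' < m \<sigma>'"
        using step less.prems unfolding wp_def by blast
      then have "wp (While b p) Q \<sigma>'' (k' + 1 + t)"
        using less exec_frame frame_trans by blast
      then obtain u \<sigma>3 where "exec (While b p) \<sigma>'' u \<sigma>3" "Q \<sigma>3 (k' + 1 + t + u)"
        unfolding wp_def by blast
      then have "exec (While b p) \<sigma>' (1 + t + u) \<sigma>3" "Q \<sigma>3 (k' + (1 + t + u))"
        using True t exec.WhileTrue by (auto simp: add.assoc)
      then show ?thesis unfolding wp_def by blast
    next
      case False
      then show ?thesis
        using exit less.prems exec.WhileFalse unfolding wp_def by blast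
    qed
  qed
  then show ?thesis using assms(1) frame_refl by blast
qed

section \<open>Searching the implication graph\<close>

text \<open>Register \<open>rZ\<close> is never written and serves as the constant 0. Arrays indexed by positions hold the
  sign (\<open>aSG\<close>), variable (\<open>aVR\<close>), literal code (\<open>aLIT\<close>) and clause (\<open>aCL\<close>) of a literal occurrence; \<open>aHD\<close>
  and \<open>aNX\<close> are linked lists of the occurrences of a literal, terminated by 0 as positions count from 1. \<open>aTN\<close> and \<open>aTP\<close> map a variable to the
  codes of its two literals, which avoids arithmetic, and \<open>aCMP\<close> maps a code to its complement. A
  literal or clause is marked in the current search if its entry in \<open>aM\<close> or \<open>aCM\<close> equals \<open>rStamp\<close>, so
  marks need not be cleared; \<open>aQ\<close> is the queue, and \<open>aFS\<close> holds the complement of the literal through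
  which a clause was entered first.\<close>

abbreviation (input) rZ :: nat where "rZ \<equiv> 0"
abbreviation (input) rN :: nat where "rN \<equiv> 1"
abbreviation (input) rM :: nat where "rM \<equiv> 2"
abbreviation (input) rP :: nat where "rP \<equiv> 3"
abbreviation (input) rK :: nat where "rK \<equiv> 4"
abbreviation (input) rC :: nat where "rC \<equiv> 5"
abbreviation (input) rS :: nat where "rS \<equiv> 6"
abbreviation (input) rV :: nat where "rV \<equiv> 7"
abbreviation (input) rX :: nat where "rX \<equiv> 8"
abbreviation (input) rY :: nat where "rY \<equiv> 9"
abbreviation (input) rT :: nat where "rT \<equiv> 10"
abbreviation (input) rI :: nat where "rI \<equiv> 11"
abbreviation (input) rJ :: nat where "rJ \<equiv> 12"
abbreviation (input) rL :: nat where "rL \<equiv> 13"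
abbreviation (input) rD :: nat where "rD \<equiv> 14"
abbreviation (input) rQH :: nat where "rQH \<equiv> 15"
abbreviation (input) rQT :: nat where "rQT \<equiv> 16"
abbreviation (input) rStamp :: nat where "rStamp \<equiv> 17"
abbreviation (input) rF :: nat where "rF \<equiv> 18"
abbreviation (input) rN1 :: nat where "rN1 \<equiv> 19"

abbreviation (input) aSG :: nat where "aSG \<equiv> 0"
abbreviation (input) aVR :: nat where "aVR \<equiv> 1"
abbreviation (input) aCL :: nat where "aCL \<equiv> 2"
abbreviation (input) aTN :: nat where "aTN \<equiv> 3"
abbreviation (input) aTP :: nat where "aTP \<equiv> 4"
abbreviation (input) aCMP :: nat where "aCMP \<equiv> 5"
abbreviation (input) aLIT :: nat where "aLIT \<equiv> 6"
abbreviation (input) aHD :: nat where "aHD \<equiv> 7"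
abbreviation (input) aNX :: nat where "aNX \<equiv> 8"
abbreviation (input) aM :: nat where "aM \<equiv> 9"
abbreviation (input) aQ :: nat where "aQ \<equiv> 10"
abbreviation (input) aCM :: nat where "aCM \<equiv> 11"
abbreviation (input) aFS :: nat where "aFS \<equiv> 12"

definition push :: prog where
  "push = Load rT aM rY ;; If (Eq rT rStamp) Skip (Store aM rY rStamp ;; Store aQ rQT rY ;; Inc rQT)"

text \<open>A clause is named by its first position, so \<open>rC\<close> is also the position at
  which the scan starts. It ends at the first position with another clause name; behind the last
  position of the formula this is the entry 0.\<close>

definition scan :: prog where
  "scan = Copy rI rC ;; Copy rD rC ;;
    While (Eq rD rC) (Load rY aLIT rI ;; If (Eq rY rL) Skip (Load rY aCMP rY ;; push) ;;
      Inc rI ;; Load rD aCL rI)"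

definition visit :: prog where
  "visit = Load rC aCL rJ ;; Load rT aCM rC ;;
    If (Eq rT rStamp) (Load rY aFS rC ;; push)
      (Store aCM rC rStamp ;; Load rY aCMP rL ;; Store aFS rC rY ;; scan)"

definition visit_all :: prog where
  "visit_all = Load rJ aHD rL ;; While (Less rZ rJ) (visit ;; Load rJ aNX rJ)"

definition explore :: prog where
  "explore = Inc rStamp ;; Const rQT 0 ;; Const rQH 0 ;; Copy rY rX ;; push ;;
    While (Less rQH rQT) (Load rL aQ rQH ;; Inc rQH ;; visit_all)"

lemma written_push [simp]:
  "written_regs push = {rT, rQT}" "written_arrs push = {aM, aQ}" "\<not> reads push" "\<not> writes push"
  by (auto simp: push_def)

lemma written_scan [simp]:
  "written_regs scan = {rT, rQT, rY, rI, rD}" "written_arrs scan = {aM, aQ}"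
  "\<not> reads scan" "\<not> writes scan"
  by (auto simp: scan_def)

lemma written_visit [simp]:
  "written_regs visit = {rT, rQT, rY, rI, rD, rC}" "written_arrs visit = {aM, aQ, aCM, aFS}"
  "\<not> reads visit" "\<not> writes visit"
  by (auto simp: visit_def)

lemma written_visit_all [simp]:
  "written_regs visit_all = {rT, rQT, rY, rI, rD, rC, rJ}"
  "written_arrs visit_all = {aM, aQ, aCM, aFS}" "\<not> reads visit_all" "\<not> writes visit_all"
  by (auto simp: visit_all_def)

lemma written_explore [simp]:
  "written_regs explore = {rStamp, rT, rQT, rQH, rY, rI, rD, rC, rJ, rL}"
  "written_arrs explore = {aM, aQ, aCM, aFS}" "\<not> reads explore" "\<not> writes explore"
  by (auto simp: explore_def)

text \<open>\<open>M0\<close> is the mark array before the current search. Its entries lie strictly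
  below the stamp, so old marks survive without being mistaken for new ones.\<close>

definition queued :: "(nat \<Rightarrow> nat) \<Rightarrow> nat list \<Rightarrow> state \<Rightarrow> bool" where
  "queued M0 q \<sigma> \<longleftrightarrow> reg \<sigma> rQT = length q \<and> (\<forall>i<length q. arr \<sigma> aQ i = q ! i) \<and> distinct q \<and>
     (\<forall>x. arr \<sigma> aM x = (if x \<in> set q then reg \<sigma> rStamp else M0 x)) \<and> (\<forall>x. M0 x < reg \<sigma> rStamp)"

lemma queued_iff: "queued M0 q \<sigma> \<Longrightarrow> arr \<sigma> aM x = reg \<sigma> rStamp \<longleftrightarrow> x \<in> set q"
  unfolding queued_def by (metis less_irrefl)

lemma queued_cong:
  assumes "queued M0 q \<sigma>" "reg \<sigma>' rQT = reg \<sigma> rQT" "reg \<sigma>' rStamp = reg \<sigma> rStamp"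
    "arr \<sigma>' aQ = arr \<sigma> aQ" "arr \<sigma>' aM = arr \<sigma> aM"
  shows "queued M0 q \<sigma>'"
  using assms by (simp add: queued_def)

lemma wp_push:
  assumes "queued M0 q \<sigma>"
  shows "wp push (\<lambda>\<sigma>' k'. queued M0 (if reg \<sigma> rY \<in> set q then q else q @ [reg \<sigma> rY]) \<sigma>' \<and> k' \<le> k + 5) \<sigma> k"
  using queued_iff [OF assms, of "reg \<sigma> rY"] assms
  by (auto simp: push_def queued_def nth_append fun_eq_iff)

text \<open>Closed form of the linked lists: occurrences are inserted at the front, so the head of
  the list of \<open>x\<close> after \<open>j\<close> positions is its last occurrence among them,
  and the successor of a position is the previous occurrence. The value 0 means that there is
  none.\<close>

fun last_occ :: "(nat \<Rightarrow> nat) \<Rightarrow> nat \<Rightarrow> nat \<Rightarrow> nat" where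
  "last_occ f x 0 = 0"
| "last_occ f x (Suc j) = (if f (Suc j) = x then Suc j else last_occ f x j)"

lemma last_occ_le: "last_occ f x j \<le> j"
  by (induction j) auto

lemma last_occ_eq: "0 < last_occ f x j \<Longrightarrow> f (last_occ f x j) = x"
  by (induction j) auto

lemma last_occ_greatest: "last_occ f x j < i \<Longrightarrow> i \<le> j \<Longrightarrow> f i \<noteq> x"
proof (induction j)
  case (Suc j)
  then show ?case by (cases "i = Suc j") (auto split: if_splits)
qed auto

text \<open>Position \<open>j\<close> of the formula holds the literal \<open>lit j\<close>; the clause to which it belongs is
  named by its first position \<open>cl j\<close>.\<close>

locale occurrences =
  fixes L :: nat and lit cl cmp head nx :: "nat \<Rightarrow> nat" and N :: "nat set"
  assumes finite_N: "finite N"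
    and cmp_N: "x \<in> N \<Longrightarrow> cmp x \<in> N"
    and cmp_cmp: "x \<in> N \<Longrightarrow> cmp (cmp x) = x"
    and lit_N: "j \<in> {1..L} \<Longrightarrow> lit j \<in> N"
    and cl_pos: "j \<in> {1..L} \<Longrightarrow> 1 \<le> cl j"
    and cl_le: "j \<in> {1..L} \<Longrightarrow> cl j \<le> j"
    and cl_cl: "j \<in> {1..L} \<Longrightarrow> cl (cl j) = cl j"
    and cl_mono: "\<lbrakk>1 \<le> i; i \<le> j; j \<le> L\<rbrakk> \<Longrightarrow> cl i \<le> cl j"
    and cl_end: "cl (Suc L) = 0"
    and lit_distinct: "\<lbrakk>i \<in> {1..L}; j \<in> {1..L}; i \<noteq> j; cl i = cl j\<rbrakk> \<Longrightarrow> lit i \<noteq> lit j"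
    and head_eq: "x \<in> N \<Longrightarrow> head x = last_occ lit x L"
    and nx_eq: "j \<in> {1..L} \<Longrightarrow> nx j = last_occ lit (lit j) (j - 1)"
begin

definition E :: "(nat \<times> nat) set" where
  "E = {(lit i, cmp (lit j)) | i j. i \<in> {1..L} \<and> j \<in> {1..L} \<and> i \<noteq> j \<and> cl i = cl j}"

definition data :: "state \<Rightarrow> bool" where
  "data \<sigma> \<longleftrightarrow> arr \<sigma> aLIT = lit \<and> arr \<sigma> aCL = cl \<and> arr \<sigma> aCMP = cmp \<and> arr \<sigma> aHD = head \<and>
     arr \<sigma> aNX = nx \<and> reg \<sigma> rZ = 0"

lemma E_N: "(x, y) \<in> E \<Longrightarrow> x \<in> N \<and> y \<in> N"
  by (auto simp: E_def lit_N cmp_N)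

text \<open>Monotonicity of \<open>cl\<close> makes every clause a block of consecutive positions,
  so a scan that stops at the first foreign position has seen all of it. The length of the interval
  then bounds the time by the clause length.\<close>

lemma clause_interval:
  assumes c: "c \<in> cl ` {1..L}" and i: "c \<le> i" "i \<le> Suc L" "cl i \<noteq> c"
    and eq: "\<forall>j\<in>{c..<i}. cl j = c"
  shows "{c..<i} = {j \<in> {1..L}. cl j = c}"
proof -
  obtain j0 where j0: "j0 \<in> {1..L}" "cl j0 = c" using c by auto
  have "j < i" if "j \<in> {1..L}" "cl j = c" for j
  proof (rule ccontr)
    assume "\<not> j < i"
    then have "1 \<le> i" "i \<le> j" "j \<le> L" "c \<le> i" "1 \<le> c"
      using that i j0 cl_pos[of j0] by auto
    then have "cl i \<le> c" "cl c \<le> cl i" using cl_mono[of i j] cl_mono[of c i] that by auto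
    then show False using i(3) cl_cl j0 by fastforce
  qed
  moreover have "c \<le> j" if "j \<in> {1..L}" "cl j = c" for j
    using that cl_le by blast
  moreover have "1 \<le> c" using j0 cl_pos by blast
  ultimately have "j \<in> {c..<i} \<longleftrightarrow> j \<in> {1..L} \<and> cl j = c" for j
    using eq i(2) by (metis atLeastAtMost_iff atLeastLessThan_iff le_trans less_Suc_eq_le order_less_le_trans)
  then show ?thesis by blast
qed

text \<open>One iteration takes at most 11 steps: the loop test, the inner branch, three loads, one
  increment and 5 steps of \<open>push\<close>. The extension \<open>e\<close> is existential
  because literals already marked are not appended.\<close>

lemma wp_scan:
  assumes q: "queued M0 q \<sigma>" and d: "data \<sigma>" and c: "reg \<sigma> rC = c" "c \<in> cl ` {1..L}"
    and l: "reg \<sigma> rL = l"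
  shows "wp scan (\<lambda>\<sigma>' k'. \<exists>e. queued M0 (q @ e) \<sigma>' \<and>
      set (q @ e) = set q \<union> {cmp (lit i) | i. i \<in> {1..L} \<and> cl i = c \<and> lit i \<noteq> l} \<and>
      k' \<le> k + 3 + 11 * card {i \<in> {1..L}. cl i = c}) \<sigma> k"
proof -
  define \<sigma>1 where "\<sigma>1 = set_reg rD c (set_reg rI c \<sigma>)"
  define I where "I \<sigma>' k' \<longleftrightarrow> (\<exists>e. queued M0 (q @ e) \<sigma>' \<and> c \<le> reg \<sigma>' rI \<and> reg \<sigma>' rI \<le> Suc L \<and>
      reg \<sigma>' rD = cl (reg \<sigma>' rI) \<and> (\<forall>j\<in>{c..<reg \<sigma>' rI}. cl j = c) \<and>
      set (q @ e) = set q \<union> {cmp (lit i) | i. i \<in> {c..<reg \<sigma>' rI} \<and> lit i \<noteq> l} \<and>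
      k' \<le> k + 2 + 11 * (reg \<sigma>' rI - c))" for \<sigma>' k'
  have c1: "1 \<le> c" "c \<le> L" "cl c = c" using c(2) cl_pos cl_le cl_cl by fastforce+
  have "wp (While (Eq rD rC) (Load rY aLIT rI ;; If (Eq rY rL) Skip (Load rY aCMP rY ;; push) ;;
      Inc rI ;; Load rD aCL rI)) (\<lambda>\<sigma>' k'. \<exists>e. queued M0 (q @ e) \<sigma>' \<and>
      set (q @ e) = set q \<union> {cmp (lit i) | i. i \<in> {1..L} \<and> cl i = c \<and> lit i \<noteq> l} \<and>
      k' \<le> k + 3 + 11 * card {i \<in> {1..L}. cl i = c}) \<sigma>1 (k + 2)"
  proof (rule wp_While [where I = I and m = "\<lambda>\<sigma>'. Suc L - reg \<sigma>' rI"], goal_cases)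
    case 1
    show ?case unfolding I_def
      by (rule exI [of _ "[]"]) (use q c1 in \<open>auto simp: \<sigma>1_def queued_def\<close>)
  next
    case (2 \<sigma>2 k2)
    then obtain e where e: "queued M0 (q @ e) \<sigma>2" "c \<le> reg \<sigma>2 rI" "reg \<sigma>2 rI \<le> Suc L"
      "reg \<sigma>2 rD = cl (reg \<sigma>2 rI)" "\<forall>j\<in>{c..<reg \<sigma>2 rI}. cl j = c"
      "set (q @ e) = set q \<union> {cmp (lit i) | i. i \<in> {c..<reg \<sigma>2 rI} \<and> lit i \<noteq> l}"
      "k2 \<le> k + 2 + 11 * (reg \<sigma>2 rI - c)" unfolding I_def by blast
    define i where "i = reg \<sigma>2 rI"
    have fr: "reg \<sigma>2 rC = c" "reg \<sigma>2 rL = l" "arr \<sigma>2 aLIT = lit" "arr \<sigma>2 aCMP = cmp" "arr \<sigma>2 aCL = cl"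
      using 2(2) c l d by (auto simp: frame_def data_def \<sigma>1_def)
    have cli: "cl i = c" using 2(3) fr e by (simp add: i_def)
    \<comment> \<open>The sentinel \<open>cl (Suc L) = 0\<close> differs from \<open>c\<close>,
      which is at least 1, so a position inside the clause cannot be \<open>Suc L\<close>.\<close>
    have iL: "i \<le> L"
      using cl_end cli c1 e(3) by (metis i_def le_SucE not_one_le_zero)
    have ran: "{c..<Suc i} = insert i {c..<i}" using e by (auto simp: i_def)
    show ?case
    proof (cases "lit i = l")
      case True
      have "{cmp (lit j) | j. j \<in> {c..<Suc i} \<and> lit j \<noteq> l} = {cmp (lit j) | j. j \<in> {c..<i} \<and> lit j \<noteq> l}"
        using True ran by auto
      then show ?thesis using e True fr cli iL unfolding I_def
        by (auto simp: i_def[symmetric] queued_def less_Suc_eq intro!: exI [of _ e])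
    next
      case False
      define \<sigma>3 where "\<sigma>3 = set_reg rY (cmp (lit i)) (set_reg rY (lit i) \<sigma>2)"
      have "queued M0 (q @ e) \<sigma>3" using e by (auto simp: queued_def \<sigma>3_def)
      note p = wp_push [OF this, of "k2 + 1 + 1 + 1 + 1"]
      have "wp push (wp (Inc rI ;; Load rD aCL rI)
          (\<lambda>\<sigma>'' k''. I \<sigma>'' k'' \<and> Suc L - reg \<sigma>'' rI < Suc L - reg \<sigma>2 rI)) \<sigma>3 (k2 + 1 + 1 + 1 + 1)"
      proof (rule wp_conseq [OF p], goal_cases)
        case (1 \<sigma>4 k4)
        have fr4: "reg \<sigma>4 rI = i" "reg \<sigma>4 rC = c" "arr \<sigma>4 aCL = cl"
          using 1(2) fr by (auto simp: frame_def \<sigma>3_def i_def)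
        obtain e' where e': "(if reg \<sigma>3 rY \<in> set (q @ e) then q @ e else (q @ e) @ [reg \<sigma>3 rY]) = q @ e'"
          "set (q @ e') = insert (reg \<sigma>3 rY) (set (q @ e))"
          by (cases "reg \<sigma>3 rY \<in> set (q @ e)") auto
        have "queued M0 (q @ e') \<sigma>4" using 1(1) unfolding e'(1) by simp
        moreover have "set (q @ e') = set q \<union> {cmp (lit j) | j. j \<in> {c..<Suc i} \<and> lit j \<noteq> l}"
          unfolding e'(2) e(6) ran using False by (auto simp: \<sigma>3_def i_def)
        moreover have "k4 + 2 \<le> k + 2 + 11 * (Suc i - c)"
          using 1(1) e by (auto simp: i_def Suc_diff_le)
        ultimately show ?case
          using fr4 cli iL e(2,5) unfolding I_def
          by (auto simp: i_def[symmetric] queued_def less_Suc_eq intro!: exI [of _ e'])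
      qed
      then show ?thesis
        using False fr iL
        by (simp add: i_def[symmetric] \<sigma>3_def)
    qed
  next
    case (3 \<sigma>2 k2)
    then obtain e where e: "queued M0 (q @ e) \<sigma>2" "c \<le> reg \<sigma>2 rI" "reg \<sigma>2 rI \<le> Suc L"
      "reg \<sigma>2 rD = cl (reg \<sigma>2 rI)" "\<forall>j\<in>{c..<reg \<sigma>2 rI}. cl j = c"
      "set (q @ e) = set q \<union> {cmp (lit i) | i. i \<in> {c..<reg \<sigma>2 rI} \<and> lit i \<noteq> l}"
      "k2 \<le> k + 2 + 11 * (reg \<sigma>2 rI - c)" unfolding I_def by blast
    have "reg \<sigma>2 rC = c" using 3(2) c by (auto simp: frame_def \<sigma>1_def)
    then have int: "{c..<reg \<sigma>2 rI} = {j \<in> {1..L}. cl j = c}"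
      using clause_interval[OF c(2) e(2,3) _ e(5)] e(4) 3(3) by simp
    then have "reg \<sigma>2 rI - c = card {j \<in> {1..L}. cl j = c}"
      by (metis card_atLeastLessThan)
    then have "k2 + 1 \<le> k + 3 + 11 * card {j \<in> {1..L}. cl j = c}" using e(7) by simp
    moreover have "set (q @ e) = set q \<union> {cmp (lit i) | i. i \<in> {1..L} \<and> cl i = c \<and> lit i \<noteq> l}"
      unfolding e(6) int by blast
    ultimately show ?case using e(1) by blast
  qed
  then show ?thesis
    using c by (simp add: scan_def \<sigma>1_def)
qed

lemma E_I:
  "\<lbrakk>i \<in> {1..L}; j \<in> {1..L}; i \<noteq> j; cl i = cl j\<rbrakk> \<Longrightarrow> (lit i, cmp (lit j)) \<in> E"
  unfolding E_def by blast

text \<open>\<open>D\<close> is the set of positions whose outgoing edges have been followed.\<close>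

definition visited :: "(nat \<Rightarrow> nat) \<Rightarrow> nat set \<Rightarrow> nat list \<Rightarrow> state \<Rightarrow> bool" where
  "visited M0 D q \<sigma> \<longleftrightarrow> queued M0 q \<sigma> \<and> (\<forall>c. arr \<sigma> aCM c \<le> reg \<sigma> rStamp) \<and>
     (\<forall>c. arr \<sigma> aCM c = reg \<sigma> rStamp \<longleftrightarrow> c \<in> cl ` D) \<and>
     (\<forall>i\<in>D. \<forall>j\<in>{1..L}. cl j = cl i \<longrightarrow> j \<noteq> i \<longrightarrow> cmp (lit j) \<in> set q) \<and>
     (\<forall>c\<in>cl ` D. \<exists>i\<in>D. cl i = c \<and> arr \<sigma> aFS c = cmp (lit i))"

text \<open>Time allowance for having visited the positions \<open>D\<close>: a constant for each of
  them, and a constant for each position of a clause touched by \<open>D\<close>. The second part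
  grows only when a clause is entered for the first time and pays for its scan.\<close>

definition cost :: "nat set \<Rightarrow> nat" where
  "cost D = 20 * card D + 20 * card {i \<in> {1..L}. cl i \<in> cl ` D}"

lemma cost_insert:
  assumes "j \<in> {1..L}" "j \<notin> D" "D \<subseteq> {1..L}"
  shows "cost (insert j D) =
    cost D + 20 + (if cl j \<in> cl ` D then 0 else 20 * card {i \<in> {1..L}. cl i = cl j})"
proof -
  have fin: "finite D" using assms finite_subset by blast
  have "card {i \<in> {1..L}. cl i \<in> cl ` insert j D} =
    card {i \<in> {1..L}. cl i \<in> cl ` D} + (if cl j \<in> cl ` D then 0 else card {i \<in> {1..L}. cl i = cl j})"
  proof (cases "cl j \<in> cl ` D")
    case True
    then have "cl ` insert j D = cl ` D" by auto
    then show ?thesis using True by simp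
  next
    case False
    have "{i \<in> {1..L}. cl i \<in> cl ` insert j D} = {i \<in> {1..L}. cl i \<in> cl ` D} \<union> {i \<in> {1..L}. cl i = cl j}"
      by auto
    moreover have "{i \<in> {1..L}. cl i \<in> cl ` D} \<inter> {i \<in> {1..L}. cl i = cl j} = {}"
      using False by auto
    ultimately show ?thesis using False by (simp add: card_Un_disjoint)
  qed
  then show ?thesis using assms fin by (simp add: cost_def)
qed

text \<open>The surplus of 5 in the time bound is left for \<open>visit_all\<close>, which spends a
  loop test and a load on each visit.\<close>

lemma wp_visit:
  assumes v: "visited M0 D q \<sigma>" and d: "data \<sigma>" and D: "D \<subseteq> {1..L}"
    and j: "j \<in> {1..L}" "j \<notin> D" "reg \<sigma> rJ = j" "reg \<sigma> rL = lit j"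
  shows "wp visit (\<lambda>\<sigma>' k'. \<exists>e. visited M0 (insert j D) (q @ e) \<sigma>' \<and> set e \<subseteq> set q \<union> E `` {lit j} \<and>
      k' + cost D + 5 \<le> k + cost (insert j D)) \<sigma> k"
proof -
  have q: "queued M0 q \<sigma>" using v by (simp add: visited_def)
  show ?thesis
  proof (cases "cl j \<in> cl ` D")
    case True
    then obtain i where i: "i \<in> D" "cl i = cl j" "arr \<sigma> aFS (cl j) = cmp (lit i)"
      using v by (metis visited_def)
    have st: "arr \<sigma> aCM (cl j) = reg \<sigma> rStamp" using v True by (simp add: visited_def)
    have step: "\<exists>e. visited M0 (insert j D) (q @ e) \<sigma>' \<and> set e \<subseteq> set q \<union> E `` {lit j} \<and>
        k' + cost D + 5 \<le> k + cost (insert j D)"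
      if p: "queued M0 (if cmp (lit i) \<in> set q then q else q @ [cmp (lit i)]) \<sigma>' \<and> k' \<le> k + 9"
        and fr: "frame push (set_reg rY (cmp (lit i)) (set_reg rT (reg \<sigma> rStamp) (set_reg rC (cl j) \<sigma>))) \<sigma>'"
      for \<sigma>' k'
    proof -
      obtain e where e: "(if cmp (lit i) \<in> set q then q else q @ [cmp (lit i)]) = q @ e"
        "set (q @ e) = insert (cmp (lit i)) (set q)"
        by (cases "cmp (lit i) \<in> set q") auto
      have f: "reg \<sigma>' rStamp = reg \<sigma> rStamp" "arr \<sigma>' aCM = arr \<sigma> aCM" "arr \<sigma>' aFS = arr \<sigma> aFS"
        using fr by (auto simp: frame_def)
      have cl: "cl ` insert j D = cl ` D" using True by auto
      have "i \<in> {1..L}" "j \<noteq> i" using i(1) j(2) D by auto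
      then have "(lit j, cmp (lit i)) \<in> E"
        using i(2) j(1) E_I by simp
      moreover have "cmp (lit a) \<in> set (q @ e)"
        if "b \<in> insert j D" "a \<in> {1..L}" "cl a = cl b" "a \<noteq> b" for a b
      proof (cases "b \<in> D")
        case True
        then show ?thesis using v that by (auto simp: visited_def)
      next
        case False
        then have "b = j" using that by simp
        \<comment> \<open>For \<open>a\<close> different from \<open>i\<close>, the invariant for
          \<open>i\<close>, a position of the same clause, already gives membership in the queue;
          for \<open>a = i\<close> the literal has just been pushed.\<close>
        then show ?thesis using v that i e(2) by (cases "a = i") (auto simp: visited_def)
      qed
      moreover have "\<forall>c\<in>cl ` insert j D. \<exists>i\<in>insert j D. cl i = c \<and> arr \<sigma>' aFS c = cmp (lit i)"
        using v unfolding cl f visited_def by blast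
      moreover have "\<forall>c. arr \<sigma>' aCM c = reg \<sigma>' rStamp \<longleftrightarrow> c \<in> cl ` insert j D"
        "\<forall>c. arr \<sigma>' aCM c \<le> reg \<sigma>' rStamp"
        using v unfolding cl f visited_def by blast+
      moreover have "queued M0 (q @ e) \<sigma>'" using p unfolding e(1) by blast
      ultimately have "visited M0 (insert j D) (q @ e) \<sigma>'"
        unfolding visited_def by (intro conjI ballI impI) blast+
      moreover have "set e \<subseteq> set (q @ e)" by simp
      then have "set e \<subseteq> set q \<union> E `` {lit j}"
        unfolding e(2) using \<open>(lit j, cmp (lit i)) \<in> E\<close> by auto
      ultimately show ?thesis using p cost_insert[OF j(1,2) D] True by auto
    qed
    show ?thesis
      using st d j i apply (simp add: visit_def data_def)
      apply (rule wp_conseq [OF wp_push [OF queued_cong [OF q]]])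
      apply simp_all
      subgoal for \<sigma>' k' by (rule step) auto
      done
  next
    case False
    let ?c = "cl j"
    define \<sigma>1 where "\<sigma>1 = set_arr aFS ?c (cmp (lit j)) (set_reg rY (cmp (lit j))
      (set_arr aCM ?c (reg \<sigma> rStamp) (set_reg rT (arr \<sigma> aCM ?c) (set_reg rC ?c \<sigma>))))"
    have st: "arr \<sigma> aCM ?c \<noteq> reg \<sigma> rStamp" using v False by (simp add: visited_def)
    have q1: "queued M0 q \<sigma>1" by (rule queued_cong [OF q]) (simp_all add: \<sigma>1_def)
    have "wp scan (\<lambda>\<sigma>' k'. \<exists>e. visited M0 (insert j D) (q @ e) \<sigma>' \<and> set e \<subseteq> set q \<union> E `` {lit j} \<and>
      k' + cost D + 5 \<le> k + cost (insert j D)) \<sigma>1 (k + 1 + 1 + 1 + 1 + 1 + 1)"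
    proof (rule wp_conseq [OF wp_scan [OF q1, where c = ?c and l = "lit j"]], goal_cases)
      case (5 \<sigma>' k')
      then obtain e where e: "queued M0 (q @ e) \<sigma>'"
        "set (q @ e) = set q \<union> {cmp (lit i) | i. i \<in> {1..L} \<and> cl i = ?c \<and> lit i \<noteq> lit j}"
        "k' \<le> k + 1 + 1 + 1 + 1 + 1 + 1 + 3 + 11 * card {i \<in> {1..L}. cl i = ?c}" by blast
      have f: "reg \<sigma>' rStamp = reg \<sigma> rStamp" "arr \<sigma>' aCM = (arr \<sigma> aCM)(?c := reg \<sigma> rStamp)"
        "arr \<sigma>' aFS = (arr \<sigma> aFS)(?c := cmp (lit j))"
        using 5(2) by (auto simp: frame_def \<sigma>1_def)
      have "set e \<subseteq> set q \<union> E `` {lit j}" 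
      proof
        fix x assume "x \<in> set e"
        then have "x \<in> set (q @ e)" by simp
        then show "x \<in> set q \<union> E `` {lit j}" 
          unfolding e(2) using j(1) E_I by fastforce
      qed
      moreover have "cmp (lit a) \<in> set (q @ e)"
        if "b \<in> insert j D" "a \<in> {1..L}" "cl a = cl b" "a \<noteq> b" for a b
      proof (cases "b \<in> D")
        case True
        then show ?thesis using v that by (auto simp: visited_def)
      next
        case False
        then have "b = j" using that by simp
        \<comment> \<open>\<open>scan\<close> skips by literal, not by position. Since the literals
          of a clause are distinct, the only position skipped is \<open>j\<close> itself.\<close>
        then show ?thesis unfolding e(2) using that lit_distinct [OF that(2) j(1)] by blast
      qed
      moreover have "\<forall>c\<in>cl ` insert j D. \<exists>i\<in>insert j D. cl i = c \<and> arr \<sigma>' aFS c = cmp (lit i)"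
      proof
        fix c assume c: "c \<in> cl ` insert j D"
        show "\<exists>i\<in>insert j D. cl i = c \<and> arr \<sigma>' aFS c = cmp (lit i)"
        proof (cases "c = cl j")
          case True
          then show ?thesis unfolding f by auto
        next
          case False
          then have "c \<in> cl ` D" using c by blast
          then obtain i where "i \<in> D" "cl i = c" "arr \<sigma> aFS c = cmp (lit i)"
            using v unfolding visited_def by blast
          then show ?thesis using False unfolding f by auto
        qed
      qed
      moreover have "\<forall>c. arr \<sigma>' aCM c = reg \<sigma>' rStamp \<longleftrightarrow> c \<in> cl ` insert j D"
        "\<forall>c. arr \<sigma>' aCM c \<le> reg \<sigma>' rStamp"
        using v unfolding f visited_def by auto
      ultimately have "visited M0 (insert j D) (q @ e) \<sigma>'" "set e \<subseteq> set q \<union> E `` {lit j}"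
        using e(1) unfolding visited_def by blast+
      then show ?case using e(3) False cost_insert[OF j(1,2) D] by (intro exI [of _ e]) auto
    qed (use d j in \<open>auto simp: \<sigma>1_def data_def\<close>)
    then show ?thesis
      using st d j by (simp add: visit_def data_def \<sigma>1_def)
  qed
qed

text \<open>\<open>P\<close> stands for the literals already taken from the queue, so that the
  visited positions are exactly their occurrences.\<close>

lemma wp_visit_all:
  assumes v: "visited M0 {i \<in> {1..L}. lit i \<in> P} q \<sigma>" and d: "data \<sigma>"
    and l: "reg \<sigma> rL = l" "l \<in> N" "l \<notin> P"
  shows "wp visit_all (\<lambda>\<sigma>' k'. \<exists>e. visited M0 {i \<in> {1..L}. lit i \<in> insert l P} (q @ e) \<sigma>' \<and>
      set e \<subseteq> set q \<union> E `` {l} \<and>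
      k' + cost {i \<in> {1..L}. lit i \<in> P} \<le> k + 2 + cost {i \<in> {1..L}. lit i \<in> insert l P}) \<sigma> k"
proof -
  \<comment> \<open>The list of \<open>l\<close> runs from its last occurrence downwards, so with
    the cursor at \<open>j\<close> exactly the occurrences above \<open>j\<close> are done; the
    terminator 0 means all of them.\<close>
  define D where "D j = {i \<in> {1..L}. lit i \<in> P \<or> lit i = l \<and> j < i}" for j
  define I where "I \<sigma>' k' \<longleftrightarrow> (\<exists>e. visited M0 (D (reg \<sigma>' rJ)) (q @ e) \<sigma>' \<and>
      set e \<subseteq> set q \<union> E `` {l} \<and> reg \<sigma>' rJ \<le> L \<and>
      (0 < reg \<sigma>' rJ \<longrightarrow> lit (reg \<sigma>' rJ) = l) \<and>
      k' + cost {i \<in> {1..L}. lit i \<in> P} \<le> k + 1 + cost (D (reg \<sigma>' rJ)))" for \<sigma>' k'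
  define \<sigma>1 where "\<sigma>1 = set_reg rJ (head l) \<sigma>"
  have D_top: "D (last_occ lit l L) = {i \<in> {1..L}. lit i \<in> P}"
    using last_occ_greatest[of lit l L] by (auto simp: D_def)
  have D_0: "D 0 = {i \<in> {1..L}. lit i \<in> insert l P}"
    by (auto simp: D_def)
  have "wp (While (Less rZ rJ) (visit ;; Load rJ aNX rJ)) (\<lambda>\<sigma>' k'. \<exists>e.
      visited M0 {i \<in> {1..L}. lit i \<in> insert l P} (q @ e) \<sigma>' \<and> set e \<subseteq> set q \<union> E `` {l} \<and>
      k' + cost {i \<in> {1..L}. lit i \<in> P} \<le> k + 2 + cost {i \<in> {1..L}. lit i \<in> insert l P}) \<sigma>1 (k + 1)"
  proof (rule wp_While [where I = I and m = "\<lambda>\<sigma>'. reg \<sigma>' rJ"], goal_cases)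
    case 1
    have "visited M0 (D (reg \<sigma>1 rJ)) (q @ []) \<sigma>1"
      using v head_eq[OF l(2)] D_top by (simp add: visited_def queued_def \<sigma>1_def)
    then show ?case
      unfolding I_def using head_eq[OF l(2)] last_occ_le[of lit l L] last_occ_eq[of lit l L] D_top
      by (intro exI [of _ "[]"]) (simp add: \<sigma>1_def)
  next
    case (2 \<sigma>2 k2)
    define j where "j = reg \<sigma>2 rJ"
    obtain e where e: "visited M0 (D j) (q @ e) \<sigma>2" "set e \<subseteq> set q \<union> E `` {l}" "j \<le> L"
      "0 < j \<longrightarrow> lit j = l" "k2 + cost {i \<in> {1..L}. lit i \<in> P} \<le> k + 1 + cost (D j)"
      using 2(1) unfolding I_def j_def[symmetric] by (elim exE conjE) (rule that)
    have d2: "data \<sigma>2" "reg \<sigma>2 rL = l"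
      using 2(2) d l(1) by (auto simp: frame_def data_def \<sigma>1_def)
    have j: "0 < j" "j \<in> {1..L}" "lit j = l"
      using 2(3) e d2 by (auto simp: data_def j_def)
    define j' where "j' = last_occ lit l (j - 1)"
    have j': "j' < j" "0 < j' \<longrightarrow> lit j' = l" "nx j = j'"
      using last_occ_le[of lit l "j - 1"] last_occ_eq[of lit l "j - 1"] j nx_eq[of j]
      by (auto simp: j'_def)
    have D': "insert j (D j) = D j'"
    proof -
      have "j \<le> i" if "lit i = l" "j' < i" "i \<in> {1..L}" for i
        using last_occ_greatest[of lit l "j - 1" i] that by (force simp: j'_def)
      then have "lit i = l \<and> j' < i \<longleftrightarrow> i = j \<or> lit i = l \<and> j < i" if "i \<in> {1..L}" for i
        using j(3) j'(1) that by (metis le_neq_implies_less order_less_trans)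
      then show ?thesis using j(2) unfolding D_def by blast
    qed
    have "wp visit (wp (Load rJ aNX rJ) (\<lambda>\<sigma>' k'. I \<sigma>' k' \<and> reg \<sigma>' rJ < reg \<sigma>2 rJ)) \<sigma>2 (k2 + 1)"
    proof (rule wp_conseq [OF wp_visit [where j = j and D = "D j", OF e(1)]], goal_cases)
      case (7 \<sigma>3 k3)
      then obtain e' where e': "visited M0 (D j') ((q @ e) @ e') \<sigma>3"
        "set e' \<subseteq> set (q @ e) \<union> E `` {l}" "k3 + cost (D j) + 5 \<le> k2 + 1 + cost (D j')"
        using D' j by auto
      have "reg \<sigma>3 rJ = j" "arr \<sigma>3 aNX = nx"
        using 7(2) d2 by (auto simp: frame_def data_def j_def)
      moreover have "visited M0 (D j') (q @ (e @ e')) (set_reg rJ j' \<sigma>3)"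
        using e'(1) by (simp add: visited_def queued_def)
      moreover have "set (e @ e') \<subseteq> set q \<union> E `` {l}"
        using e(2) e'(2) by auto
      moreover have "k3 + 1 + cost {i \<in> {1..L}. lit i \<in> P} \<le> k + 1 + cost (D j')"
        using e(5) e'(3) by linarith
      moreover have "j' \<le> L" using j'(1) e(3) by linarith
      ultimately have "I (set_reg rJ j' \<sigma>3) (k3 + 1)"
        unfolding I_def using j'(2) by (intro exI [of _ "e @ e'"]) simp
      then show ?case
        using \<open>reg \<sigma>3 rJ = j\<close> \<open>arr \<sigma>3 aNX = nx\<close> j' by (simp add: j_def)
    qed (use d2 j l in \<open>auto simp: D_def j_def\<close>)
    then show ?case by simp
  next
    case (3 \<sigma>2 k2)
    have "reg \<sigma>2 rJ = 0"
      using 3 d by (auto simp: frame_def data_def \<sigma>1_def)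
    then show ?case using 3(1) D_0 by (auto simp: I_def)
  qed
  then show ?thesis
    using d l by (simp add: visit_all_def \<sigma>1_def data_def)
qed

section \<open>Reachable sets and the cost of one search\<close>

definition reach :: "nat \<Rightarrow> nat set" where
  "reach x = E\<^sup>* `` {x}"

definition weight :: "nat set \<Rightarrow> nat" where
  "weight U = card U + card {i \<in> {1..L}. lit i \<in> U}"

lemma reach_N: "x \<in> N \<Longrightarrow> reach x \<subseteq> N"
proof -
  have "(x, y) \<in> E\<^sup>* \<Longrightarrow> x \<in> N \<Longrightarrow> y \<in> N" for y
    by (induction rule: rtrancl_induct) (auto dest: E_N)
  then show "x \<in> N \<Longrightarrow> reach x \<subseteq> N" by (auto simp: reach_def)
qed

lemma reach_step: "y \<in> reach x \<Longrightarrow> (y, z) \<in> E \<Longrightarrow> z \<in> reach x"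
  by (auto simp: reach_def)

lemma reach_least:
  assumes "x \<in> A" and "\<And>y z. y \<in> A \<Longrightarrow> (y, z) \<in> E \<Longrightarrow> z \<in> A"
  shows "reach x \<subseteq> A"
proof -
  have "(x, y) \<in> E\<^sup>* \<Longrightarrow> y \<in> A" for y
    by (induction rule: rtrancl_induct) (use assms in auto)
  then show ?thesis by (auto simp: reach_def)
qed

text \<open>If a clause has an occurrence of a literal of \<open>R\<close>, every other literal of
  it has its complement in \<open>R\<close> and hence lies in \<open>cmp\<close>
  R\<open>. So all positions of touched clauses carry literals of\<close>R \<union> cmp
  \<open>R\<close>. The summand \<open>20 * card R\<close> leaves room for the overhead of the
  queue.\<close>

lemma cost_le_weight:
  assumes cl: "\<And>i j. \<lbrakk>i \<in> {1..L}; j \<in> {1..L}; lit i \<in> R; i \<noteq> j; cl i = cl j\<rbrakk> \<Longrightarrow> cmp (lit j) \<in> R"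
    and R: "R \<subseteq> N"
  shows "20 * card R + cost {i \<in> {1..L}. lit i \<in> R} \<le> 40 * weight (R \<union> cmp ` R)"
proof -
  let ?U = "R \<union> cmp ` R" and ?D = "{i \<in> {1..L}. lit i \<in> R}"
  have fin: "finite R" using finite_subset[OF R finite_N] .
  have "lit i \<in> ?U" if i: "i \<in> {1..L}" "cl i \<in> cl ` ?D" for i
  proof -
    obtain j where j: "j \<in> {1..L}" "lit j \<in> R" "cl i = cl j" using i(2) by blast
    then have "j = i \<or> cmp (lit i) \<in> R" using cl i(1) by metis
    then show ?thesis using j cmp_cmp[OF lit_N[OF i(1)]] by (metis Un_iff image_eqI)
  qed
  then have "card {i \<in> {1..L}. cl i \<in> cl ` ?D} \<le> card {i \<in> {1..L}. lit i \<in> ?U}"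
    by (intro card_mono) auto
  moreover have "card ?D \<le> card {i \<in> {1..L}. lit i \<in> ?U}" "card R \<le> card ?U"
    using fin by (auto intro!: card_mono)
  ultimately show ?thesis by (simp add: cost_def weight_def)
qed

lemma wp_explore:
  assumes d: "data \<sigma>" and x: "reg \<sigma> rX = x" "x \<in> N"
    and M: "\<forall>y. arr \<sigma> aM y \<le> reg \<sigma> rStamp" and CM: "\<forall>c. arr \<sigma> aCM c \<le> reg \<sigma> rStamp"
  shows "wp explore (\<lambda>\<sigma>' k'. \<exists>q. queued (arr \<sigma> aM) q \<sigma>' \<and> set q = reach x \<and>
      reg \<sigma>' rStamp = reg \<sigma> rStamp + 1 \<and> (\<forall>c. arr \<sigma>' aCM c \<le> reg \<sigma>' rStamp) \<and>
      k' \<le> k + 20 + 40 * weight (reach x \<union> cmp ` reach x)) \<sigma> k"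
proof -
  define \<sigma>1 where "\<sigma>1 = set_reg rY x (set_reg rQH 0 (set_reg rQT 0
    (set_reg rStamp (Suc (reg \<sigma> rStamp)) \<sigma>)))"
  let ?M0 = "arr \<sigma> aM"
  let ?D = "\<lambda>A. {i \<in> {1..L}. lit i \<in> A}"
  \<comment> \<open>The first \<open>rQH\<close> queue entries are the processed literals. When the
    queue is exhausted they are all of \<open>q\<close>, which is then closed under edges and so
    equals \<open>reach x\<close>.\<close>
  define I where "I \<sigma>' k' \<longleftrightarrow> (\<exists>q. visited ?M0 (?D (set (take (reg \<sigma>' rQH) q))) q \<sigma>' \<and>
      reg \<sigma>' rQH \<le> length q \<and> x \<in> set q \<and> set q \<subseteq> reach x \<and>
      k' \<le> k + 9 + 6 * reg \<sigma>' rQH + cost (?D (set (take (reg \<sigma>' rQH) q))))" for \<sigma>' k'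
  let ?Q = "\<lambda>\<sigma>' k'. \<exists>q. queued ?M0 q \<sigma>' \<and> set q = reach x \<and>
      reg \<sigma>' rStamp = reg \<sigma> rStamp + 1 \<and> (\<forall>c. arr \<sigma>' aCM c \<le> reg \<sigma>' rStamp) \<and>
      k' \<le> k + 20 + 40 * weight (reach x \<union> cmp ` reach x)"
  have q0: "queued ?M0 [] \<sigma>1"
    using M by (simp add: queued_def \<sigma>1_def le_imp_less_Suc)
  have "wp push (wp (While (Less rQH rQT) (Load rL aQ rQH ;; Inc rQH ;; visit_all)) ?Q) \<sigma>1
    (k + 1 + 1 + 1 + 1)"
  proof (rule wp_conseq [OF wp_push [OF q0]])
    fix \<sigma>2 k2
    assume 2: "queued ?M0 (if reg \<sigma>1 rY \<in> set [] then [] else [] @ [reg \<sigma>1 rY]) \<sigma>2 \<and>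
        k2 \<le> k + 1 + 1 + 1 + 1 + 5" "frame push \<sigma>1 \<sigma>2"
    have f2: "data \<sigma>2" "reg \<sigma>2 rStamp = reg \<sigma> rStamp + 1" "arr \<sigma>2 aCM = arr \<sigma> aCM" "reg \<sigma>2 rQH = 0"
      using 2(2) d by (auto simp: frame_def data_def \<sigma>1_def)
    show "wp (While (Less rQH rQT) (Load rL aQ rQH ;; Inc rQH ;; visit_all)) ?Q \<sigma>2 k2"
    proof (rule wp_While [where I = I and m = "\<lambda>\<sigma>'. card N - reg \<sigma>' rQH"], goal_cases)
      case 1
      have "\<forall>c. arr \<sigma> aCM c \<noteq> Suc (reg \<sigma> rStamp)" "\<forall>c. arr \<sigma> aCM c \<le> Suc (reg \<sigma> rStamp)"
        using CM by (metis Suc_n_not_le_n, metis le_SucI)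
      then have "visited ?M0 {} [x] \<sigma>2"
        using 2(1) f2 by (simp add: visited_def \<sigma>1_def)
      then show ?case unfolding I_def
        by (intro exI [of _ "[x]"]) (use 2 f2 in \<open>auto simp: reach_def\<close>)
    next
      case (2 \<sigma>3 k3)
      define h where "h = reg \<sigma>3 rQH"
      obtain q where q: "visited ?M0 (?D (set (take h q))) q \<sigma>3" "h \<le> length q" "x \<in> set q"
        "set q \<subseteq> reach x" "k3 \<le> k + 9 + 6 * h + cost (?D (set (take h q)))"
        using 2(1) unfolding I_def h_def by blast
      have q': "queued ?M0 q \<sigma>3" "distinct q" using q(1) by (auto simp: visited_def queued_def)
      have hq: "h < length q" using 2(3) q' by (simp add: h_def queued_def)
      \<comment> \<open>The queue is duplicate-free and stays inside \<open>N\<close>, so its head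
        cannot pass \<open>card N\<close>; this makes the loop measure decrease.\<close>
      have "card (set q) \<le> card N"
        using q(4) reach_N[OF x(2)] card_mono[OF finite_N] by blast
      then have "h < card N"
        using hq q'(2) by (simp add: distinct_card)
      have d3: "data \<sigma>3" using 2(2) f2 by (auto simp: frame_def data_def)
      have qh: "arr \<sigma>3 aQ h = q ! h" using q' hq by (simp add: queued_def)
      have take: "set (take (Suc h) q) = insert (q ! h) (set (take h q))"
        using hq by (simp add: take_Suc_conv_app_nth)
      have nin: "q ! h \<notin> set (take h q)"
        using hq q'(2) by (metis distinct_take take_Suc_conv_app_nth not_distinct_conv_prefix)
      have qN: "q ! h \<in> reach x" using q(4) hq nth_mem by blast
      define \<sigma>4 where "\<sigma>4 = set_reg rQH (Suc h) (set_reg rL (q ! h) \<sigma>3)"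
      have v4: "visited ?M0 (?D (set (take h q))) q \<sigma>4"
        using q(1) by (simp add: visited_def queued_def \<sigma>4_def)
      have "wp visit_all (\<lambda>\<sigma>' k'. I \<sigma>' k' \<and> card N - reg \<sigma>' rQH < card N - reg \<sigma>3 rQH) \<sigma>4 (k3 + 1 + 1 + 1)"
      proof (rule wp_conseq [OF wp_visit_all [OF v4, where l = "q ! h"]], goal_cases)
        case (5 \<sigma>5 k5)
        then obtain e where e: "visited ?M0 (?D (set (take (Suc h) q))) (q @ e) \<sigma>5"
          "set e \<subseteq> set q \<union> E `` {q ! h}"
          "k5 + cost (?D (set (take h q))) \<le> k3 + 5 + cost (?D (set (take (Suc h) q)))"
          unfolding take by auto
        have f5: "reg \<sigma>5 rQH = Suc h" using 5(2) by (auto simp: frame_def \<sigma>4_def)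
        have "set e \<subseteq> reach x" using e(2) q(4) qN reach_step by blast
        then show ?case using e q hq \<open>h < card N\<close> f5 unfolding I_def
          by (intro conjI exI [of _ "q @ e"]) (auto simp: h_def[symmetric])
      qed (use d3 reach_N[OF x(2)] qN nin in \<open>auto simp: \<sigma>4_def data_def\<close>)
      then show ?case using qh by (simp add: \<sigma>4_def h_def)
    next
      case (3 \<sigma>3 k3)
      define h where "h = reg \<sigma>3 rQH"
      obtain q where q: "visited ?M0 (?D (set (take h q))) q \<sigma>3" "h \<le> length q" "x \<in> set q"
        "set q \<subseteq> reach x" "k3 \<le> k + 9 + 6 * h + cost (?D (set (take h q)))"
        using 3(1) unfolding I_def h_def by blast
      have q': "queued ?M0 q \<sigma>3" "distinct q" using q(1) by (auto simp: visited_def queued_def)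
      have "h = length q" using 3(3) q' q(2) by (simp add: h_def queued_def)
      then have h: "take h q = q" "h = card (set q)" using q'(2) by (simp_all add: distinct_card)
      have closed: "cmp (lit j) \<in> set q"
        if "i \<in> {1..L}" "j \<in> {1..L}" "lit i \<in> set q" "i \<noteq> j" "cl i = cl j" for i j
        using q(1) that unfolding h(1) visited_def by auto
      then have "reach x \<subseteq> set q"
        using q(3) by (intro reach_least) (auto simp: E_def)
      then have R: "set q = reach x" using q(4) by blast
      have "20 * card (reach x) + cost (?D (reach x)) \<le> 40 * weight (reach x \<union> cmp ` reach x)"
        using closed reach_N[OF x(2)] unfolding R by (intro cost_le_weight) auto
      then have "k3 + 1 \<le> k + 20 + 40 * weight (reach x \<union> cmp ` reach x)"
        using q(5) unfolding h(1) unfolding h(2) R by linarith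
      moreover have "reg \<sigma>3 rStamp = reg \<sigma> rStamp + 1" using 3(2) f2 by (simp add: frame_def)
      ultimately show ?case using q(1) R q' by (auto simp: visited_def)
    qed
  qed
  then show ?thesis
    using x by (simp add: explore_def \<sigma>1_def)
qed

end

section \<open>Finding a consistent closed set\<close>

definition check :: prog where
  "check = Const rI 0 ;; While (Less rI rQT) (Load rY aQ rI ;; Load rL aCMP rY ;; Load rT aM rL ;;
    If (Eq rT rStamp) Skip (Const rF 1 ;; Copy rX rY) ;; Inc rI)"

definition attempt :: prog where
  "attempt = explore ;; check"

text \<open>Any nonzero mark suffices to skip a literal: the loop goes on only after failures, and
  then every marked literal is unusable. Testing the positive literal of a variable is enough
  because unusable sets are closed under complement. After a success, \<open>rV\<close> is moved to
  the end to leave the loop.\<close>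

definition search :: prog where
  "search = Const rV 1 ;;
    While (Less rV rN1)
      (Load rX aTP rV ;; Load rT aM rX ;;
       If (Eq rT rZ) (attempt ;; If (Eq rF rZ) (Load rX aTN rV ;; attempt) Skip) Skip ;;
       Inc rV ;; If (Eq rF rZ) Skip (Copy rV rN1))"

text \<open>The hit in \<open>rX\<close> need not be the literal from which the search started, and
  only the set reachable from the hit is known to be consistent. It is therefore explored anew under
  a fresh stamp; a marked negative literal means that its variable is renamed.\<close>

definition report :: prog where
  "report = Write rF ;;
    If (Eq rF rZ) Skip
      (explore ;; Const rV 1 ;;
       While (Less rV rN1)
         (Load rY aTN rV ;; Load rT aM rY ;; If (Eq rT rStamp) (Write rV) Skip ;; Inc rV))"

lemma written_check [simp]:
  "written_regs check = {rI, rY, rL, rT, rF, rX}" "written_arrs check = {}"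
  "\<not> reads check" "\<not> writes check"
  by (auto simp: check_def)

lemma written_attempt [simp]:
  "written_regs attempt = {rStamp, rT, rQT, rQH, rY, rI, rD, rC, rJ, rL, rF, rX}"
  "written_arrs attempt = {aM, aQ, aCM, aFS}" "\<not> reads attempt" "\<not> writes attempt"
  by (auto simp: attempt_def)

lemma written_search [simp]:
  "written_regs search = {rStamp, rT, rQT, rQH, rY, rI, rD, rC, rJ, rL, rF, rX, rV}"
  "written_arrs search = {aM, aQ, aCM, aFS}" "\<not> reads search" "\<not> writes search"
  by (auto simp: search_def)

context occurrences
begin

section \<open>Skew symmetry: edges come from unordered pairs of positions, so every path has a
  mirror image\<close>

lemma E_skew: "(x, y) \<in> E \<Longrightarrow> (cmp y, cmp x) \<in> E"
  unfolding E_def using cmp_cmp lit_N by fastforce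

lemma reach_skew:
  assumes "x \<in> N" "y \<in> reach x"
  shows "cmp x \<in> reach (cmp y)"
proof -
  have "(x, y) \<in> E\<^sup>* \<Longrightarrow> (cmp y, cmp x) \<in> E\<^sup>*"
  proof (induction rule: rtrancl_induct)
    case (step y z)
    then show ?case using E_skew converse_rtrancl_into_rtrancl by metis
  qed simp
  then show ?thesis using assms by (simp add: reach_def)
qed

lemma reach_refl: "x \<in> reach x"
  by (simp add: reach_def)

lemma reach_trans: "y \<in> reach x \<Longrightarrow> reach y \<subseteq> reach x"
  by (auto simp: reach_def)

text \<open>A path from \<open>x\<close> to \<open>cmp y\<close> mirrors to one from
  \<open>y\<close> to \<open>cmp x\<close>. Together with a path from \<open>x\<close> to
  \<open>y\<close> it would lead from \<open>x\<close> to \<open>cmp x\<close>.\<close>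

lemma reach_consistent:
  assumes "x \<in> N" "cmp x \<notin> reach x" "y \<in> reach x"
  shows "cmp y \<notin> reach x"
proof
  assume "cmp y \<in> reach x"
  then have "cmp x \<in> reach (cmp (cmp y))" using reach_skew assms(1) by blast
  moreover have "cmp (cmp y) = y" using assms reach_N cmp_cmp by blast
  ultimately show False using reach_trans assms by auto
qed

lemma weight_Un: "\<lbrakk>finite A; finite B; A \<inter> B = {}\<rbrakk> \<Longrightarrow> weight (A \<union> B) = weight A + weight B"
proof -
  assume a: "finite A" "finite B" "A \<inter> B = {}"
  have "{i \<in> {1..L}. lit i \<in> A \<union> B} = {i \<in> {1..L}. lit i \<in> A} \<union> {i \<in> {1..L}. lit i \<in> B}" by auto
  moreover have "{i \<in> {1..L}. lit i \<in> A} \<inter> {i \<in> {1..L}. lit i \<in> B} = {}" using a by auto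
  ultimately show ?thesis using a by (simp add: weight_def card_Un_disjoint)
qed

lemma weight_mono: "\<lbrakk>A \<subseteq> B; finite B\<rbrakk> \<Longrightarrow> weight A \<le> weight B"
  unfolding weight_def by (intro add_mono card_mono) auto

lemma symmetric_image:
  assumes "A \<subseteq> N" "\<forall>x\<in>A. cmp x \<in> A"
  shows "A \<union> cmp ` A = A"
  using assms by auto

lemma wp_check:
  assumes q: "queued M0 q \<sigma>" and d: "data \<sigma>" and F: "reg \<sigma> rF = 0"
  shows "wp check (\<lambda>\<sigma>' k'.
      (reg \<sigma>' rF = 0 \<and> (\<forall>x\<in>set q. cmp x \<in> set q) \<or>
       reg \<sigma>' rF = 1 \<and> reg \<sigma>' rX \<in> set q \<and> cmp (reg \<sigma>' rX) \<notin> set q) \<and>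
      k' \<le> k + 2 + 8 * length q) \<sigma> k"
proof -
  define I where "I \<sigma>' k' \<longleftrightarrow> reg \<sigma>' rI \<le> length q \<and>
      (reg \<sigma>' rF = 0 \<and> (\<forall>i<reg \<sigma>' rI. cmp (q ! i) \<in> set q) \<or>
       reg \<sigma>' rF = 1 \<and> reg \<sigma>' rX \<in> set q \<and> cmp (reg \<sigma>' rX) \<notin> set q) \<and>
      k' \<le> k + 1 + 8 * reg \<sigma>' rI" for \<sigma>' :: state and k'
  have "wp (While (Less rI rQT) (Load rY aQ rI ;; Load rL aCMP rY ;; Load rT aM rL ;;
    If (Eq rT rStamp) Skip (Const rF 1 ;; Copy rX rY) ;; Inc rI)) (\<lambda>\<sigma>' k'.
      (reg \<sigma>' rF = 0 \<and> (\<forall>x\<in>set q. cmp x \<in> set q) \<or>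
       reg \<sigma>' rF = 1 \<and> reg \<sigma>' rX \<in> set q \<and> cmp (reg \<sigma>' rX) \<notin> set q) \<and>
      k' \<le> k + 2 + 8 * length q) (set_reg rI 0 \<sigma>) (k + 1)"
  proof (rule wp_While [where I = I and m = "\<lambda>\<sigma>'. length q - reg \<sigma>' rI"], goal_cases)
    case 1
    show ?case using F by (simp add: I_def)
  next
    case (2 \<sigma>2 k2)
    define i where "i = reg \<sigma>2 rI"
    have f: "reg \<sigma>2 rQT = length q" "reg \<sigma>2 rStamp = reg \<sigma> rStamp" "arr \<sigma>2 = arr \<sigma>"
      using 2(2) q by (auto simp: frame_def queued_def)
    have i: "i < length q" using 2(3) f by (simp add: i_def)
    have qi: "arr \<sigma>2 aQ i = q ! i" "arr \<sigma>2 aCMP = cmp"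
      "arr \<sigma>2 aM (cmp (q ! i)) = reg \<sigma>2 rStamp \<longleftrightarrow> cmp (q ! i) \<in> set q"
      using q d i queued_iff[OF q] unfolding f by (auto simp: queued_def data_def)
    show ?case
      using 2(1) i qi f nth_mem[OF i]
      by (auto simp: I_def i_def[symmetric] less_Suc_eq)
  next
    case (3 \<sigma>2 k2)
    have "reg \<sigma>2 rQT = length q"
      using 3(2) q by (auto simp: frame_def queued_def)
    then have "reg \<sigma>2 rI = length q" using 3 by (simp add: I_def)
    then show ?case using 3(1) unfolding I_def
      by (auto simp: all_set_conv_all_nth)
  qed
  then show ?thesis by (simp add: check_def)
qed

definition stamped :: "state \<Rightarrow> bool" where
  "stamped \<sigma> \<longleftrightarrow> (\<forall>y. arr \<sigma> aM y \<le> reg \<sigma> rStamp) \<and> (\<forall>c. arr \<sigma> aCM c \<le> reg \<sigma> rStamp)"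

text \<open>A complement missing from \<open>reach x\<close> is also missing from the smaller set
  \<open>reach y\<close> of a hit \<open>y\<close>, so the hit can be stated without mentioning
  \<open>x\<close>. The factor 48 is 40 for \<open>explore\<close> and 8 per queue entry for
  \<open>check\<close>.\<close>

lemma wp_attempt:
  assumes d: "data \<sigma>" and x: "reg \<sigma> rX = x" "x \<in> N" and s: "stamped \<sigma>" and F: "reg \<sigma> rF = 0"
  shows "wp attempt (\<lambda>\<sigma>' k'. stamped \<sigma>' \<and> reg \<sigma>' rStamp = reg \<sigma> rStamp + 1 \<and>
      (\<forall>y. arr \<sigma>' aM y = (if y \<in> reach x then reg \<sigma>' rStamp else arr \<sigma> aM y)) \<and>
      (reg \<sigma>' rF = 0 \<and> (\<forall>y\<in>reach x. cmp y \<in> reach x) \<or>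
       reg \<sigma>' rF = 1 \<and> reg \<sigma>' rX \<in> N \<and> cmp (reg \<sigma>' rX) \<notin> reach (reg \<sigma>' rX)) \<and>
      k' \<le> k + 22 + 48 * weight (reach x \<union> cmp ` reach x)) \<sigma> k"
proof -
  have fin: "finite (reach x)" using reach_N[OF x(2)] finite_N finite_subset by blast
  show ?thesis
    unfolding attempt_def wp_Seq
  proof (rule wp_conseq [OF wp_explore [OF d x]], goal_cases)
    case (3 \<sigma>1 k1)
    then obtain q where q: "queued (arr \<sigma> aM) q \<sigma>1" "set q = reach x"
      "reg \<sigma>1 rStamp = reg \<sigma> rStamp + 1" "\<forall>c. arr \<sigma>1 aCM c \<le> reg \<sigma>1 rStamp"
      "k1 \<le> k + 20 + 40 * weight (reach x \<union> cmp ` reach x)" by blast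
    have "data \<sigma>1" "reg \<sigma>1 rF = 0" using 3(2) d F by (auto simp: frame_def data_def)
    note c = wp_check [OF q(1) this]
    have "length q \<le> weight (reach x \<union> cmp ` reach x)"
    proof -
      have "length q = card (reach x)" using q(1,2) by (metis distinct_card queued_def)
      also have "\<dots> \<le> card (reach x \<union> cmp ` reach x)" using fin by (intro card_mono) auto
      finally show ?thesis by (simp add: weight_def)
    qed
    note len = this
    show ?case
    proof (rule wp_conseq [OF c], goal_cases)
      case (1 \<sigma>2 k2)
      have f: "arr \<sigma>2 = arr \<sigma>1" "reg \<sigma>2 rStamp = reg \<sigma>1 rStamp"
        using 1(2) by (auto simp: frame_def)
      have "cmp y \<notin> reach y" if "y \<in> reach x" "cmp y \<notin> reach x" for y
        using reach_trans that by blast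
      moreover have "stamped \<sigma>2"
        using q(1,4) s unfolding stamped_def f queued_def by (simp add: less_imp_le)
      moreover have "\<forall>y. arr \<sigma>2 aM y = (if y \<in> reach x then reg \<sigma>2 rStamp else arr \<sigma> aM y)"
        using q(1,2) f by (simp add: queued_def)
      ultimately show ?case
        using 1(1) q(2,3,5) len f(2) reach_N[OF x(2)] by auto
    qed
  qed (use s in \<open>auto simp: stamped_def\<close>)
qed

text \<open>After two failures \<open>x\<close> and \<open>cmp x\<close> reach each other. A literal
  \<open>y\<close> reached from \<open>x\<close> has its complement reached as well, and the mirror
  image of that path leads from \<open>y\<close> back to \<open>cmp x\<close>.\<close>

lemma isolated_component:
  assumes x: "x \<in> N" and R: "\<forall>y\<in>reach x. cmp y \<in> reach x"
    and R': "\<forall>y\<in>reach (cmp x). cmp y \<in> reach (cmp x)"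
  shows "reach (cmp x) = reach x" and "\<And>y. y \<in> reach x \<Longrightarrow> reach y = reach x"
proof -
  have "cmp x \<in> reach x" using R reach_refl by blast
  moreover have "x \<in> reach (cmp x)" using R' reach_refl cmp_cmp[OF x] by metis
  ultimately show eq: "reach (cmp x) = reach x" using reach_trans by blast
  fix y assume y: "y \<in> reach x"
  then have "cmp y \<in> reach x" using R by blast
  then have "cmp x \<in> reach (cmp (cmp y))" using reach_skew x by blast
  moreover have "y \<in> N" using y reach_N x by blast
  ultimately have "cmp x \<in> reach y" using cmp_cmp by simp
  then show "reach y = reach x" using eq reach_trans y by blast
qed

end

locale literal_occurrences = occurrences +
  fixes n :: nat
  assumes N_eq: "N = {2..2 * n + 1}"
    and cmp_even: "v \<in> {1..n} \<Longrightarrow> cmp (2 * v) = 2 * v + 1"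
    and cmp_odd: "v \<in> {1..n} \<Longrightarrow> cmp (2 * v + 1) = 2 * v"
begin

definition table :: "state \<Rightarrow> bool" where
  "table \<sigma> \<longleftrightarrow> reg \<sigma> rN1 = n + 1 \<and> (\<forall>v\<in>{1..n}. arr \<sigma> aTN v = 2 * v \<and> arr \<sigma> aTP v = 2 * v + 1)"

text \<open>\<open>cmp x \<in> reach x\<close> excludes \<open>x\<close> from every consistent
  closed set. Closure under complement and reachability is what separates a discarded set from all
  later searches.\<close>

definition dead :: "nat set \<Rightarrow> bool" where
  "dead D \<longleftrightarrow> D \<subseteq> N \<and> (\<forall>x\<in>D. cmp x \<in> D \<and> cmp x \<in> reach x \<and> reach x \<subseteq> D)"

lemma dead_Un: "dead A \<Longrightarrow> dead B \<Longrightarrow> dead (A \<union> B)"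
  unfolding dead_def by blast

text \<open>A path from \<open>x\<close> to some \<open>y\<close> in \<open>D\<close> mirrors to one
  from \<open>cmp y\<close>, also in \<open>D\<close>, to \<open>cmp x\<close>; closure then puts
  \<open>x\<close> into \<open>D\<close>. Thus a search started outside never enters
  \<open>D\<close>, although the program does not check this.\<close>

lemma dead_disjoint:
  assumes D: "dead D" and x: "x \<in> N" "x \<notin> D"
  shows "D \<inter> reach x = {}"
proof -
  have False if y: "y \<in> D" "y \<in> reach x" for y
  proof -
    have "cmp x \<in> reach (cmp y)" using reach_skew x(1) y(2) by blast
    then have "cmp x \<in> D" using D y(1) unfolding dead_def by blast
    then have "cmp (cmp x) \<in> D" using D unfolding dead_def by blast
    then show False using x cmp_cmp by simp
  qed
  then show ?thesis by blast
qed

definition found :: "state \<Rightarrow> bool" where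
  "found \<sigma> \<longleftrightarrow> reg \<sigma> rF = 1 \<and> reg \<sigma> rX \<in> N \<and> cmp (reg \<sigma> rX) \<notin> reach (reg \<sigma> rX)"

text \<open>If both searches fail they cover the same set, and 48 times its weight for each is
  exactly the growth of the potential \<open>96 * weight D\<close>. If one succeeds, the two sets
  may differ, and each is bounded by \<open>N\<close>; this happens once.\<close>

lemma wp_two_attempts:
  assumes d: "data \<sigma>" and t: "table \<sigma>" and v: "reg \<sigma> rV = v" "v \<in> {1..n}"
    and x: "reg \<sigma> rX = 2 * v + 1" and s: "stamped \<sigma>" and F: "reg \<sigma> rF = 0"
    and D: "dead D" "\<forall>y. arr \<sigma> aM y \<noteq> 0 \<longleftrightarrow> y \<in> D" "2 * v + 1 \<notin> D"
  shows "wp (attempt ;; If (Eq rF rZ) (Load rX aTN rV ;; attempt) Skip) (\<lambda>\<sigma>' k'. stamped \<sigma>' \<and>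
      (found \<sigma>' \<and> k' \<le> k + 60 + 96 * weight N \<or>
       reg \<sigma>' rF = 0 \<and> (\<exists>D'. dead D' \<and> (\<forall>y. arr \<sigma>' aM y \<noteq> 0 \<longleftrightarrow> y \<in> D') \<and> D \<subseteq> D' \<and> 2 * v + 1 \<in> D' \<and>
         k' + 96 * weight D \<le> k + 60 + 96 * weight D'))) \<sigma> k"
proof -
  define x where "x = 2 * v + 1"
  have xN: "x \<in> N" and cx: "cmp x = 2 * v" using v cmp_odd by (auto simp: x_def N_eq)
  have c2: "2 * v \<in> N" using cmp_N[OF xN] cx by simp
  have sub: "weight (reach y \<union> cmp ` reach y) \<le> weight N" if "y \<in> N" for y
    using reach_N[OF that] cmp_N finite_N by (intro weight_mono) auto
  show ?thesis
    unfolding wp_Seq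
  proof (rule wp_conseq [OF wp_attempt [where x = x, OF d]], goal_cases)
    case (5 \<sigma>1 k1)
    have f1: "data \<sigma>1" "table \<sigma>1" "reg \<sigma>1 rV = v"
      using 5(2) d t v by (auto simp: frame_def data_def table_def)
    show ?case
    proof (cases "reg \<sigma>1 rF = 0")
      case False
      then show ?thesis
        using 5(1) f1 sub[OF xN] by (auto simp: data_def found_def)
    next
      case True
      define \<sigma>2 where "\<sigma>2 = set_reg rX (2 * v) \<sigma>1"
      have R: "\<forall>y\<in>reach x. cmp y \<in> reach x" and st: "stamped \<sigma>1" using 5(1) True by auto
      have w: "weight (reach x \<union> cmp ` reach x) = weight (reach x)"
        using symmetric_image[OF reach_N[OF xN] R] by simp
      have "wp attempt (\<lambda>\<sigma>' k'. stamped \<sigma>' \<and>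
        (found \<sigma>' \<and> k' \<le> k + 60 + 96 * weight N \<or>
         reg \<sigma>' rF = 0 \<and> (\<exists>D'. dead D' \<and> (\<forall>y. arr \<sigma>' aM y \<noteq> 0 \<longleftrightarrow> y \<in> D') \<and> D \<subseteq> D' \<and> 2 * v + 1 \<in> D' \<and>
           k' + 96 * weight D \<le> k + 60 + 96 * weight D'))) \<sigma>2 (k1 + 1 + 1)"
      proof (rule wp_conseq [OF wp_attempt [where x = "cmp x"]], goal_cases)
        case (6 \<sigma>3 k3)
        show ?case
        proof (cases "reg \<sigma>3 rF = 0")
          case False
          then show ?thesis
            using 5(1) 6(1) sub[OF xN] sub[OF cmp_N[OF xN]] by (auto simp: found_def)
        next
          case True
          then have R': "\<forall>y\<in>reach (cmp x). cmp y \<in> reach (cmp x)" using 6(1) by auto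
          note iso = isolated_component[OF xN R R']
          have "dead (reach x)"
            using reach_N[OF xN] R iso(2) unfolding dead_def by blast
          then have dead: "dead (D \<union> reach x)" using D dead_Un by blast
          have fin: "finite D" "finite (reach x)"
            using D(1) reach_N[OF xN] finite_N finite_subset unfolding dead_def by blast+
          have "weight (D \<union> reach x) = weight D + weight (reach x)"
            using dead_disjoint[OF D(1) xN] D(3) fin by (intro weight_Un) (auto simp: x_def)
          then have "k3 + 96 * weight D \<le> k + 60 + 96 * weight (D \<union> reach x)"
            using 5(1) 6(1) w unfolding iso(1) by linarith
          moreover have "\<forall>y. arr \<sigma>3 aM y \<noteq> 0 \<longleftrightarrow> y \<in> D \<union> reach x"
            using 5(1) 6(1) D(2) unfolding iso(1) by (auto simp: \<sigma>2_def)
          ultimately show ?thesis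
            using True 6(1) dead reach_refl[of x] by (auto simp: x_def)
        qed
      qed (use f1 True st c2 cx in \<open>auto simp: \<sigma>2_def data_def stamped_def\<close>)
      then show ?thesis
        using True f1 v by (simp add: \<sigma>2_def data_def table_def)
    qed
  qed (use x xN s F in \<open>auto simp: x_def\<close>)
qed

lemma wp_search:
  assumes d: "data \<sigma>" and t: "table \<sigma>" and M: "arr \<sigma> aM = (\<lambda>_. 0)" "arr \<sigma> aCM = (\<lambda>_. 0)"
    and F: "reg \<sigma> rF = 0" 
  shows "wp search (\<lambda>\<sigma>' k'. stamped \<sigma>' \<and>
      (found \<sigma>' \<or> reg \<sigma>' rF = 0 \<and> (\<forall>x\<in>N. cmp x \<in> reach x)) \<and>
      k' \<le> k + 80 + 80 * n + 200 * weight N) \<sigma> k"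
proof -
  \<comment> \<open>While nothing is found, failures are paid by \<open>96 * weight D\<close> and
    each variable adds at most 80 steps of overhead. A success adds another
    \<open>96 * weight N\<close>, and both together fit into \<open>200 * weight N\<close>.\<close>
  define I where "I \<sigma>' k' \<longleftrightarrow> stamped \<sigma>' \<and>
      (found \<sigma>' \<and> reg \<sigma>' rV = n + 1 \<and> k' \<le> k + 70 + 80 * n + 200 * weight N \<or>
       reg \<sigma>' rF = 0 \<and> 1 \<le> reg \<sigma>' rV \<and> reg \<sigma>' rV \<le> n + 1 \<and>
       (\<exists>D. dead D \<and> (\<forall>y. arr \<sigma>' aM y \<noteq> 0 \<longleftrightarrow> y \<in> D) \<and> (\<forall>v\<in>{1..<reg \<sigma>' rV}. 2 * v + 1 \<in> D) \<and>
         k' \<le> k + 1 + 80 * (reg \<sigma>' rV - 1) + 96 * weight D))" for \<sigma>' k'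
  have wN: "weight D \<le> weight N" if "dead D" for D
    using that finite_N unfolding dead_def by (intro weight_mono) auto
  let ?two = "attempt ;; If (Eq rF rZ) (Load rX aTN rV ;; attempt) Skip"
  have "wp (While (Less rV rN1)
      (Load rX aTP rV ;; Load rT aM rX ;; If (Eq rT rZ) ?two Skip ;;
       Inc rV ;; If (Eq rF rZ) Skip (Copy rV rN1))) 
    (\<lambda>\<sigma>' k'. stamped \<sigma>' \<and>
      (found \<sigma>' \<or> reg \<sigma>' rF = 0 \<and> (\<forall>x\<in>N. cmp x \<in> reach x)) \<and>
      k' \<le> k + 80 + 80 * n + 200 * weight N) (set_reg rV 1 \<sigma>) (k + 1)"
  proof (rule wp_While [where I = I and m = "\<lambda>\<sigma>'. n + 1 - reg \<sigma>' rV"], goal_cases)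
    case 1
    have "dead {}" by (simp add: dead_def)
    then show ?case unfolding I_def
      using F M by (auto simp: stamped_def)
  next
    case (2 \<sigma>2 k2)
    define v where "v = reg \<sigma>2 rV"
    have f2: "data \<sigma>2" "table \<sigma>2" using 2(2) d t by (auto simp: frame_def data_def table_def)
    have rZ: "reg \<sigma>2 rZ = 0" using f2(1) by (simp add: data_def)
    have vn: "v < n + 1" using 2(3) f2 by (simp add: v_def table_def)
    then obtain D where D: "stamped \<sigma>2" "reg \<sigma>2 rF = 0" "1 \<le> v" "dead D"
      "\<forall>y. arr \<sigma>2 aM y \<noteq> 0 \<longleftrightarrow> y \<in> D" "\<forall>w\<in>{1..<v}. 2 * w + 1 \<in> D"
      "k2 \<le> k + 1 + 80 * (v - 1) + 96 * weight D"
      using 2(1) unfolding I_def v_def by auto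
    have v: "v \<in> {1..n}" "arr \<sigma>2 aTP v = 2 * v + 1" using vn D(3) f2(2) by (auto simp: table_def)
    show ?case
    proof (cases "2 * v + 1 \<in> D")
      case True
      have "\<forall>w\<in>{1..<Suc v}. 2 * w + 1 \<in> D" using D(6) True by (auto simp: less_Suc_eq)
      moreover have "arr \<sigma>2 aM (2 * v + 1) \<noteq> 0" using True D(5) by blast
      moreover have "k2 + 20 \<le> k + 1 + 80 * v + 96 * weight D" using D(3,7) by auto
      ultimately show ?thesis
        using D(1,2,4,5) v(2) rZ vn
        by (auto simp: v_def[symmetric] I_def stamped_def simp del: neq0_conv intro!: exI [of _ D])
    next
      case False
      define \<sigma>3 where "\<sigma>3 = set_reg rT 0 (set_reg rX (2 * v + 1) \<sigma>2)"
      have m0: "arr \<sigma>2 aM (2 * v + 1) = 0" using False D(5) by blast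
      have "wp ?two (wp (Inc rV ;; If (Eq rF rZ) Skip (Copy rV rN1))
          (\<lambda>\<sigma>'' k''. I \<sigma>'' k'' \<and> n + 1 - reg \<sigma>'' rV < n + 1 - reg \<sigma>2 rV)) \<sigma>3 (k2 + 1 + 1 + 1 + 1)"
      proof (rule wp_conseq [OF wp_two_attempts [where v = v and D = D]], goal_cases)
        case (11 \<sigma>4 k4)
        have f4: "reg \<sigma>4 rV = v" "reg \<sigma>4 rZ = 0" "reg \<sigma>4 rN1 = n + 1"
          using 11(2) f2 by (auto simp: frame_def data_def table_def \<sigma>3_def v_def)
        show ?case
        proof (cases "found \<sigma>4")
          case True
          have "v - 1 + 1 \<le> n" using v(1) by auto
          then have "k4 + 4 \<le> k + 70 + 80 * n + 200 * weight N"
            using True 11(1) D(7) wN[OF D(4)] by (auto simp: found_def)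
          then show ?thesis
            using True 11(1) f4 vn by (auto simp: v_def[symmetric] I_def found_def stamped_def)
        next
          case False
          then obtain D' where D': "reg \<sigma>4 rF = 0" "dead D'" "\<forall>y. arr \<sigma>4 aM y \<noteq> 0 \<longleftrightarrow> y \<in> D'"
            "D \<subseteq> D'" "2 * v + 1 \<in> D'"
            "k4 + 96 * weight D \<le> k2 + 1 + 1 + 1 + 1 + 60 + 96 * weight D'"
            using 11(1) by auto
          have "\<forall>w\<in>{1..<Suc v}. 2 * w + 1 \<in> D'" using D(6) D' by (auto simp: less_Suc_eq)
          moreover have "k4 + 3 \<le> k + 1 + 80 * v + 96 * weight D'" using D' D(7) v(1) by auto
          ultimately show ?thesis
            using 11(1) f4 vn D' by (auto simp: v_def[symmetric] I_def stamped_def intro!: exI [of _ D'])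
        qed
      qed (use f2 D v False in \<open>auto simp: \<sigma>3_def data_def table_def stamped_def v_def\<close>)
      then show ?thesis
        using m0 v rZ by (simp add: v_def[symmetric] \<sigma>3_def)
    qed
  next
    case (3 \<sigma>2 k2)
    have N1: "reg \<sigma>2 rN1 = n + 1" using 3(2) t by (auto simp: frame_def table_def)
    show ?case
    proof (cases "found \<sigma>2")
      case True
      then show ?thesis using 3(1) by (auto simp: I_def found_def)
    next
      case False
      then obtain D where D: "stamped \<sigma>2" "reg \<sigma>2 rF = 0" "reg \<sigma>2 rV = n + 1" "dead D"
        "\<forall>w\<in>{1..<n + 1}. 2 * w + 1 \<in> D" "k2 \<le> k + 1 + 80 * n + 96 * weight D"
        using 3 N1 by (auto simp: I_def)
      \<comment> \<open>The invariant records only positive literals; closure of \<open>D\<close>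
        under complement supplies the negative ones.\<close>
      have "cmp x \<in> reach x" if x: "x \<in> N" for x
      proof -
        define v where "v = x div 2"
        have v: "v \<in> {1..n}" "x = 2 * v \<or> x = 2 * v + 1"
          using x unfolding N_eq v_def by auto
        then have "2 * v + 1 \<in> D" using D(5) by auto
        moreover from this have "2 * v \<in> D" using D(4) cmp_odd[OF v(1)] by (metis dead_def)
        ultimately have "x \<in> D" using v by blast
        then show ?thesis using D(4) by (simp add: dead_def)
      qed
      then show ?thesis using D wN[OF D(4)] by auto
    qed
  qed
  then show ?thesis by (simp add: search_def)
qed

lemma wp_report:
  assumes d: "data \<sigma>" and t: "table \<sigma>" and s: "stamped \<sigma>" and o: "out \<sigma> = []"
    and F: "found \<sigma> \<or> reg \<sigma> rF = 0"
  shows "wp report (\<lambda>\<sigma>' k'.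
      out \<sigma>' = (if reg \<sigma> rF = 0 then [0]
        else 1 # filter (\<lambda>v. 2 * v \<in> reach (reg \<sigma> rX)) [1..<n + 1]) \<and>
      k' \<le> k + 30 + 10 * n + 40 * weight N) \<sigma> k"
proof (cases "reg \<sigma> rF = 0")
  case True
  then show ?thesis using d o by (simp add: report_def data_def)
next
  case False
  then have F: "found \<sigma>" using F by simp
  define x where "x = reg \<sigma> rX"
  have x: "x \<in> N" using F by (simp add: found_def x_def)
  have w: "weight (reach x \<union> cmp ` reach x) \<le> weight N"
    using reach_N[OF x] cmp_N finite_N by (intro weight_mono) auto
  define \<sigma>1 where "\<sigma>1 = \<sigma>\<lparr>out := [1]\<rparr>"
  let ?sel = "\<lambda>j. filter (\<lambda>v. 2 * v \<in> reach x) [1..<j]"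
  let ?Q = "\<lambda>\<sigma>' k'. out \<sigma>' = 1 # ?sel (n + 1) \<and> k' \<le> k + 30 + 10 * n + 40 * weight N"
  let ?loop = "While (Less rV rN1)
         (Load rY aTN rV ;; Load rT aM rY ;; If (Eq rT rStamp) (Write rV) Skip ;; Inc rV)"
  have "wp explore (wp (Const rV 1 ;; ?loop) ?Q) \<sigma>1 (k + 1 + 1)"
  proof (rule wp_conseq [OF wp_explore [where x = x]], goal_cases)
    case (6 \<sigma>2 k2)
    then obtain q where q: "queued (arr \<sigma>1 aM) q \<sigma>2" "set q = reach x"
      "k2 \<le> k + 1 + 1 + 20 + 40 * weight (reach x \<union> cmp ` reach x)" by blast
    have f2: "table \<sigma>2" "out \<sigma>2 = [1]" using 6(2) t by (auto simp: frame_def table_def \<sigma>1_def)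
    define I where "I \<sigma>' k' \<longleftrightarrow> 1 \<le> reg \<sigma>' rV \<and> reg \<sigma>' rV \<le> n + 1 \<and>
      out \<sigma>' = 1 # ?sel (reg \<sigma>' rV) \<and> k' \<le> k2 + 1 + 6 * (reg \<sigma>' rV - 1)" for \<sigma>' :: state and k'
    have "wp ?loop ?Q (set_reg rV 1 \<sigma>2) (k2 + 1)"
    proof (rule wp_While [where I = I and m = "\<lambda>\<sigma>'. n + 1 - reg \<sigma>' rV"], goal_cases)
      case 1
      show ?case using f2 by (simp add: I_def)
    next
      case (2 \<sigma>3 k3)
      define v where "v = reg \<sigma>3 rV"
      have f3: "arr \<sigma>3 = arr \<sigma>2" "reg \<sigma>3 rStamp = reg \<sigma>2 rStamp" "reg \<sigma>3 rN1 = n + 1"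
        using 2(2) f2 by (auto simp: frame_def table_def)
      have v: "1 \<le> v" "v \<le> n" using 2(1,3) f3 by (auto simp: I_def v_def)
      have "arr \<sigma>3 aTN v = 2 * v" using f2(1) v f3 by (auto simp: table_def)
      moreover have "arr \<sigma>3 aM (2 * v) = reg \<sigma>3 rStamp \<longleftrightarrow> 2 * v \<in> reach x"
        using queued_iff[OF q(1)] q(2) f3 by simp
      ultimately show ?case
        using 2(1) v by (auto simp: I_def v_def[symmetric] upt_Suc_append)
    next
      case (3 \<sigma>3 k3)
      have "reg \<sigma>3 rN1 = n + 1" using 3(2) f2 by (auto simp: frame_def table_def)
      then have "reg \<sigma>3 rV = n + 1" using 3(1,3) by (auto simp: I_def)
      then show ?case using 3(1) q(3) w by (auto simp: I_def)
    qed
    then show ?case by simp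
  qed (use d s x in \<open>auto simp: data_def stamped_def \<sigma>1_def x_def\<close>)
  moreover have "reg \<sigma> rZ = 0" "reg \<sigma> rF = 1" using d F by (simp_all add: data_def found_def)
  ultimately show ?thesis
    using o unfolding report_def \<sigma>1_def x_def[symmetric] by simp
qed

end

section \<open>Partially Horn renamings as closed sets of literals\<close>

fun code :: "nat literal \<Rightarrow> nat" where
  "code (Pos v) = 2 * v + 1"
| "code (Neg v) = 2 * v"

fun neg :: "'v literal \<Rightarrow> 'v literal" where
  "neg (Pos v) = Neg v"
| "neg (Neg v) = Pos v"

lemma neg_neg [simp]: "neg (neg l) = l"
  by (cases l) auto

lemma var_neg [simp]: "var (neg l) = var l"
  by (cases l) auto

lemma code_inject [simp]: "code l = code l' \<longleftrightarrow> l = l'"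
  by (cases l; cases l') (auto, presburger+)

text \<open>\<open>A\<close> plays the role of the literals that are positive after the renaming and whose
  variables form \<open>V\<^sub>0\<close>.\<close>

definition horn_closed :: "'v formula \<Rightarrow> 'v literal set \<Rightarrow> bool" where
  "horn_closed \<phi> A \<longleftrightarrow> A \<noteq> {} \<and> (\<forall>l\<in>A. neg l \<notin> A) \<and>
     (\<forall>C\<in>set \<phi>. \<forall>l\<in>set C. \<forall>l'\<in>set C. l \<in> A \<longrightarrow> l' \<noteq> l \<longrightarrow> neg l' \<in> A)"

lemma var_rename_literal [simp]: "var (rename_literal W l) = var l"
  by (cases l) auto

lemma clause_vars_rename: "clause_vars (map (rename_literal W) C) = clause_vars C"
  by (simp add: clause_vars_def image_image)

lemma ball_rename:
  "(\<forall>C\<in>set (rename W \<phi>). P C) \<longleftrightarrow> (\<forall>C\<in>set \<phi>. P (map (rename_literal W) C))"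
  by (simp add: rename_def)

lemma finite_Pos: "finite {x. Pos x \<in> set C}"
  using finite_vimageI [of "set C" Pos] by (simp add: vimage_def inj_def)

lemma horn_closed_partially_horn:
  assumes A: "horn_closed \<phi> A" and V: "var ` A \<subseteq> V"
  shows "partially_horn V (rename {v. Neg v \<in> A} \<phi>)"
proof -
  let ?W = "{v. Neg v \<in> A}"
  let ?r = "rename_literal ?W"
  have cons: "neg l \<notin> A" if "l \<in> A" for l using A that by (simp add: horn_closed_def)
  have closed: "neg l' \<in> A" if "C \<in> set \<phi>" "l \<in> set C" "l' \<in> set C" "l \<in> A" "l' \<noteq> l" for C l l'
    using A that by (simp add: horn_closed_def)
  have pos: "\<exists>l\<in>set C. l \<in> A \<and> var l = x" if x: "Pos x \<in> set (map ?r C)" "x \<in> var ` A" for C x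
  proof -
    obtain l where l: "l \<in> set C" "?r l = Pos x" using x(1) by auto
    obtain l0 where l0: "l0 \<in> A" "var l0 = x" using x(2) by auto
    have "l \<in> A \<and> var l = x"
      using l(2) l0 by (cases l; cases l0) (auto split: if_splits)
    then show ?thesis using l(1) by blast
  qed
  have "horn (map ?r C)" if C: "C \<in> set \<phi>" "clause_vars C \<subseteq> var ` A" for C
  proof -
    have "x = y" if xy: "Pos x \<in> set (map ?r C)" "Pos y \<in> set (map ?r C)" for x y
    proof -
      have "x \<in> clause_vars (map ?r C)" "y \<in> clause_vars (map ?r C)"
        unfolding clause_vars_def
        using image_eqI[OF _ xy(1), of x var] image_eqI[OF _ xy(2), of y var] by simp_all
      then have xA: "x \<in> var ` A" "y \<in> var ` A"
        using C(2) unfolding clause_vars_rename by (simp_all add: subset_iff)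
      then obtain l l' where "l \<in> set C" "l \<in> A" "var l = x" "l' \<in> set C" "l' \<in> A" "var l' = y"
        using pos [OF xy(1) xA(1)] pos [OF xy(2) xA(2)] by blast
      then show ?thesis using closed[OF C(1)] cons by metis
    qed
    then show ?thesis
      unfolding horn_def One_nat_def card_le_Suc0_iff_eq [OF finite_Pos] by blast
  qed
  moreover have "Pos x \<notin> set (map ?r C)"
    if C: "C \<in> set \<phi>" "\<not> clause_vars C \<subseteq> var ` A" "x \<in> var ` A" for C x
  proof
    assume "Pos x \<in> set (map ?r C)"
    then obtain l where l: "l \<in> set C" "l \<in> A" using pos C(3) by blast
    obtain l' where l': "l' \<in> set C" "var l' \<notin> var ` A" using C(2) by (auto simp: clause_vars_def)
    then have "neg l' \<in> A" using closed[OF C(1) l(1) l'(1) l(2)] l(2) by blast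
    then show False using l'(2) by (metis image_eqI var_neg)
  qed
  ultimately show ?thesis
    using A V unfolding partially_horn_def ball_rename clause_vars_rename horn_closed_def
    by (intro exI [of _ "var ` A"]) blast
qed

text \<open>A clause with a literal of \<open>A\<close> has a positive occurrence over
  \<open>V0\<close>, so it cannot be mixed and lies over \<open>V0\<close>. Being Horn, it then has
  no further positive literal, and the complements of its other literals are in
  \<open>A\<close>.\<close>

lemma partially_horn_horn_closed:
  assumes ph: "partially_horn V (rename W \<phi>)" and d: "\<forall>C\<in>set \<phi>. distinct (map var C)"
  shows "\<exists>A. horn_closed \<phi> A \<and> var ` A \<subseteq> V"
proof -
  obtain V0 where V0': "V0 \<subseteq> V" "V0 \<noteq> {}"
    "\<forall>C\<in>set (rename W \<phi>). clause_vars C \<subseteq> V0 \<longrightarrow> horn C"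
    "\<forall>C\<in>set (rename W \<phi>). \<not> clause_vars C \<subseteq> V0 \<longrightarrow> (\<forall>x\<in>V0. Pos x \<notin> set C)"
    using ph unfolding partially_horn_def by blast
  have V0: "horn (map (rename_literal W) C)" if "C \<in> set \<phi>" "clause_vars C \<subseteq> V0" for C
    using V0'(3) that unfolding ball_rename clause_vars_rename by blast
  have V0_mixed: "Pos x \<notin> set (map (rename_literal W) C)"
    if "C \<in> set \<phi>" "\<not> clause_vars C \<subseteq> V0" "x \<in> V0" for C x
    using V0'(4) that unfolding ball_rename clause_vars_rename by blast
  define A where "A = {l. var l \<in> V0 \<and> rename_literal W l = Pos (var l)}"
  have "A \<noteq> {}"
  proof -
    obtain v where "v \<in> V0" using V0'(2) by blast
    then have "(if v \<in> W then Neg v else Pos v) \<in> A" by (simp add: A_def)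
    then show ?thesis by blast
  qed
  moreover have "neg l \<notin> A" if "l \<in> A" for l
    using that by (cases l) (auto simp: A_def split: if_splits)
  moreover have "neg l' \<in> A"
    if C: "C \<in> set \<phi>" "l \<in> set C" "l' \<in> set C" and l: "l \<in> A" "l' \<noteq> l" for C l l'
  proof -
    have ne: "var l' \<noteq> var l"
      using d C l(2) by (auto simp: distinct_map inj_on_def)
    have p: "Pos (var l) \<in> set (map (rename_literal W) C)"
      using C(2) l(1) by (force simp: A_def)
    have sub: "clause_vars C \<subseteq> V0"
      using V0_mixed [OF C(1)] p l(1) unfolding A_def by blast
    have "Pos (var l') \<notin> set (map (rename_literal W) C)"
      using V0 [OF C(1) sub] p ne
      unfolding horn_def One_nat_def card_le_Suc0_iff_eq [OF finite_Pos] by blast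
    then have "rename_literal W l' \<noteq> Pos (var l')" using C(3) by force
    then have "rename_literal W (neg l') = Pos (var l')" by (cases l') (auto split: if_splits)
    moreover have "var l' \<in> V0" using sub C(3) by (auto simp: clause_vars_def)
    ultimately show ?thesis by (simp add: A_def)
  qed
  ultimately have "horn_closed \<phi> A" unfolding horn_closed_def by blast
  moreover have "var ` A \<subseteq> V" using V0'(1) by (auto simp: A_def)
  ultimately show ?thesis by blast
qed

text \<open>The occurrences in reading order, numbered from \<open>s\<close>, each tagged with the
  first position of its clause. Empty clauses leave no trace, which is harmless as they are Horn and
  lie over every \<open>V0\<close>.\<close>

fun layout :: "nat \<Rightarrow> 'v formula \<Rightarrow> ('v literal \<times> nat) list" where
  "layout s [] = []"
| "layout s (C # \<phi>) = map (\<lambda>l. (l, s)) C @ layout (s + length C) \<phi>"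

lemma layout_append: "layout s (\<phi> @ \<psi>) = layout s \<phi> @ layout (s + length (layout s \<phi>)) \<psi>"
  by (induction \<phi> arbitrary: s) (auto simp: add.assoc)

lemma length_layout: "length (layout s \<phi>) + length \<phi> = formula_length \<phi>"
  by (induction \<phi> arbitrary: s) (auto simp: formula_length_def)

lemma layout_bounds:
  "i < length (layout s \<phi>) \<Longrightarrow> s \<le> snd (layout s \<phi> ! i) \<and> snd (layout s \<phi> ! i) \<le> s + i"
proof (induction \<phi> arbitrary: s i)
  case (Cons C \<phi>)
  show ?case
  proof (cases "i < length C")
    case False
    then have "i - length C < length (layout (s + length C) \<phi>)" using Cons.prems by auto
    then show ?thesis using Cons.IH False by (fastforce simp: nth_append)
  qed (simp add: nth_append)
qed simp

lemma layout_mono: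
  "i \<le> j \<Longrightarrow> j < length (layout s \<phi>) \<Longrightarrow> snd (layout s \<phi> ! i) \<le> snd (layout s \<phi> ! j)"
proof (induction \<phi> arbitrary: s i j)
  case (Cons C \<phi>)
  show ?case
  proof (cases "j < length C")
    case False
    then have j: "j - length C < length (layout (s + length C) \<phi>)" using Cons.prems by auto
    show ?thesis
    proof (cases "i < length C")
      case True
      then show ?thesis using layout_bounds [OF j] False by (simp add: nth_append)
    next
      case i: False
      then show ?thesis
        using Cons.IH [OF _ j, of "i - length C"] Cons.prems(1) False by (simp add: nth_append)
    qed
  qed (use Cons.prems in \<open>simp add: nth_append\<close>)
qed simp

lemma layout_start:
  "i < length (layout s \<phi>) \<Longrightarrow> snd (layout s \<phi> ! (snd (layout s \<phi> ! i) - s)) = snd (layout s \<phi> ! i)"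
proof (induction \<phi> arbitrary: s i)
  case (Cons C \<phi>)
  show ?case
  proof (cases "i < length C")
    case False
    then have i: "i - length C < length (layout (s + length C) \<phi>)" using Cons.prems by auto
    then have "\<not> snd (layout (s + length C) \<phi> ! (i - length C)) - s < length C"
      using layout_bounds [OF i] by linarith
    then show ?thesis using Cons.IH [OF i] False by (simp add: nth_append)
  qed (auto simp: nth_append)
qed simp

text \<open>Occurrences of a first clause \<open>C\<close> carry the tag \<open>s\<close> and later
  ones at least \<open>s + length C\<close>, which is larger as soon as \<open>C\<close> has an
  occurrence. So tags identify clauses despite empty ones.\<close>

lemma layout_same_clause:
  assumes "i < length (layout s \<phi>)" "j < length (layout s \<phi>)"
    and "snd (layout s \<phi> ! i) = snd (layout s \<phi> ! j)" and "i \<noteq> j"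
  shows "\<exists>C\<in>set \<phi>. \<exists>a<length C. \<exists>b<length C. a \<noteq> b \<and> fst (layout s \<phi> ! i) = C ! a \<and> fst (layout s \<phi> ! j) = C ! b"
  using assms
proof (induction \<phi> arbitrary: s i j)
  case (Cons C \<phi>)
  have b: "s + length C \<le> snd (layout (s + length C) \<phi> ! (m - length C))"
    if "m < length (layout s (C # \<phi>))" "\<not> m < length C" for m
    using layout_bounds [of "m - length C" "s + length C" \<phi>] that by auto
  show ?case
  proof (cases "i < length C")
    case True
    then have "j < length C" using Cons.prems b[of j] by (auto simp: nth_append split: if_splits)
    then show ?thesis using True Cons.prems by (auto simp: nth_append)
  next
    case False
    then have "\<not> j < length C" using Cons.prems b[of i] by (auto simp: nth_append split: if_splits)
    then show ?thesis
      using False Cons.prems Cons.IH [of "i - length C" "s + length C" "j - length C"]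
      by (auto simp: nth_append)
  qed
qed simp

lemma layout_clause:
  assumes "C \<in> set \<phi>" "a < length C" "b < length C"
  shows "\<exists>i<length (layout s \<phi>). \<exists>j<length (layout s \<phi>).
    layout s \<phi> ! i = (C ! a, snd (layout s \<phi> ! j)) \<and> fst (layout s \<phi> ! j) = C ! b"
  using assms
proof (induction \<phi> arbitrary: s)
  case (Cons D \<phi>)
  show ?case
  proof (cases "C = D")
    case True
    then show ?thesis using Cons.prems
      by (intro exI [of _ a] conjI exI [of _ b]) (auto simp: nth_append)
  next
    case False
    then obtain i j where "i < length (layout (s + length D) \<phi>)" "j < length (layout (s + length D) \<phi>)"
      "layout (s + length D) \<phi> ! i = (C ! a, snd (layout (s + length D) \<phi> ! j))"
      "fst (layout (s + length D) \<phi> ! j) = C ! b"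
      using Cons.prems Cons.IH [of "s + length D"] by auto
    then have "length D + i < length (layout s (D # \<phi>))" "length D + j < length (layout s (D # \<phi>))"
      "layout s (D # \<phi>) ! (length D + i) = (C ! a, snd (layout s (D # \<phi>) ! (length D + j)))"
      "fst (layout s (D # \<phi>) ! (length D + j)) = C ! b"
      by (simp_all add: nth_append)
    then show ?thesis by blast
  qed
qed simp

lemma unused_variable:
  assumes "length (layout 1 \<phi>) < n"
  shows "\<exists>v\<in>{1..n}. \<forall>C\<in>set \<phi>. v \<notin> clause_vars C"
proof (rule ccontr)
  assume none: "\<not> ?thesis"
  have "{1..n} \<subseteq> (\<lambda>p. var (fst p)) ` set (layout 1 \<phi>)"
  proof
    fix v assume "v \<in> {1..n}"
    then obtain C where C': "C \<in> set \<phi>" "v \<in> clause_vars C" using none by blast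
    then obtain l where C: "C \<in> set \<phi>" "l \<in> set C" "var l = v"
      unfolding clause_vars_def by blast
    then obtain a where "a < length C" "C ! a = l" by (auto simp: in_set_conv_nth)
    then obtain i where "i < length (layout 1 \<phi>)" "fst (layout 1 \<phi> ! i) = l"
      using layout_clause [OF C(1), of a a 1] by auto
    then show "v \<in> (\<lambda>p. var (fst p)) ` set (layout 1 \<phi>)"
      using C(3) by (metis image_eqI nth_mem)
  qed
  then have "card {1..n} \<le> card ((\<lambda>p. var (fst p)) ` set (layout 1 \<phi>))"
    by (intro card_mono) auto
  also have "\<dots> \<le> card (set (layout 1 \<phi>))" by (intro card_image_le) auto
  also have "\<dots> \<le> length (layout 1 \<phi>)" by (rule card_length)
  finally show False using assms by simp
qed

text \<open>For a variable \<open>v\<close> that does not occur, \<open>{Pos v}\<close> is vacuously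
  closed; it has no negative literal, so nothing is renamed.\<close>

lemma partially_horn_unused_variable:
  assumes "length (layout 1 \<phi>) < n"
  shows "partially_horn {1..n} (rename {} \<phi>)"
proof -
  obtain v where v: "v \<in> {1..n}" "\<forall>C\<in>set \<phi>. v \<notin> clause_vars C"
    using unused_variable [OF assms] by blast
  then have "horn_closed \<phi> {Pos v}"
    by (force simp: horn_closed_def clause_vars_def)
  then show ?thesis using horn_closed_partially_horn[of \<phi> "{Pos v}" "{1..n}"] v(1) by simp
qed

section \<open>Reading the formula\<close>

fun sign :: "'v literal \<Rightarrow> nat" where
  "sign (Pos v) = 1"
| "sign (Neg v) = 0"

lemma encode_literal_eq: "encode_literal l = [sign l, var l]"
  by (cases l) auto

definition read_clause :: prog where
  "read_clause = While (Less rZ rK)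
    (Dec rK ;; Read rS ;; Read rV ;; Store aSG rP rS ;; Store aVR rP rV ;; Store aCL rP rC ;; Inc rP)"

definition read_formula :: prog where
  "read_formula = Read rN ;; Read rM ;; Const rP 1 ;;
    While (Less rZ rM) (Dec rM ;; Read rK ;; Copy rC rP ;; read_clause)"

text \<open>Counting from 0 keeps \<open>rX\<close> at twice \<open>rV\<close> by increments alone,
  so the codes are obtained without multiplication.\<close>

definition fill_tables :: prog where
  "fill_tables = Copy rN1 rN ;; Inc rN1 ;; Const rV 0 ;; Const rX 0 ;;
    While (Less rV rN1)
      (Store aTN rV rX ;; Copy rY rX ;; Inc rY ;; Store aTP rV rY ;; Store aCMP rX rY ;;
       Store aCMP rY rX ;; Inc rY ;; Copy rX rY ;; Inc rV)"

definition link :: prog where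
  "link = Const rJ 1 ;;
    While (Less rJ rP)
      (Load rS aSG rJ ;; Load rV aVR rJ ;; If (Eq rS rZ) (Load rX aTN rV) (Load rX aTP rV) ;;
       Store aLIT rJ rX ;; Load rT aHD rX ;; Store aNX rJ rT ;; Store aHD rX rJ ;; Inc rJ)"

text \<open>\<open>rP\<close> is one more than the number of literal occurrences, so the test asks
  whether there are at most as many variables as occurrences. Otherwise the output is the success
  flag with an empty renaming.\<close>

definition main :: prog where
  "main = read_formula ;;
    If (Less rN rP) (fill_tables ;; link ;; search ;; report) (Const rF 1 ;; Write rF)"

lemma written_read_clause [simp]:
  "written_regs read_clause = {rK, rS, rV, rP}" "written_arrs read_clause = {aSG, aVR, aCL}"
  "\<not> writes read_clause"
  by (auto simp: read_clause_def)

lemma written_read_formula [simp]: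
  "written_regs read_formula = {rN, rM, rC, rK, rS, rV, rP}"
  "written_arrs read_formula = {aSG, aVR, aCL}" "\<not> writes read_formula"
  by (auto simp: read_formula_def)

lemma written_fill_tables [simp]:
  "written_regs fill_tables = {rN1, rV, rX, rY}" "written_arrs fill_tables = {aTN, aTP, aCMP}"
  "\<not> writes fill_tables"
  by (auto simp: fill_tables_def)

lemma written_link [simp]:
  "written_regs link = {rJ, rS, rV, rX, rT}" "written_arrs link = {aLIT, aHD, aNX}"
  "\<not> writes link"
  by (auto simp: link_def)

text \<open>\<open>aCL\<close> is fixed at all indices because the 0 behind the last position is the
  sentinel of clause scans; it comes from the initial memory.\<close>

definition loaded :: "(nat literal \<times> nat) list \<Rightarrow> state \<Rightarrow> bool" where
  "loaded W \<sigma> \<longleftrightarrow> reg \<sigma> rP = length W + 1 \<and>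
     (\<forall>j. arr \<sigma> aCL j = (if j \<in> {1..length W} then snd (W ! (j - 1)) else 0)) \<and>
     (\<forall>j\<in>{1..length W}. arr \<sigma> aSG j = sign (fst (W ! (j - 1))) \<and> arr \<sigma> aVR j = var (fst (W ! (j - 1))))"

lemma wp_read_clause:
  assumes W: "loaded W \<sigma>" and K: "reg \<sigma> rK = length C" and rZ: "reg \<sigma> rZ = 0"
    and inp: "inp \<sigma> = concat (map encode_literal C) @ rest"
  shows "wp read_clause (\<lambda>\<sigma>' k'. loaded (W @ map (\<lambda>l. (l, reg \<sigma> rC)) C) \<sigma>' \<and> inp \<sigma>' = rest \<and>
      k' \<le> k + 1 + 8 * length C) \<sigma> k"
proof -
  let ?W = "\<lambda>C1. W @ map (\<lambda>l. (l, reg \<sigma> rC)) C1"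
  define I where "I \<sigma>' k' \<longleftrightarrow> (\<exists>C1 C2. C = C1 @ C2 \<and> reg \<sigma>' rK = length C2 \<and>
      inp \<sigma>' = concat (map encode_literal C2) @ rest \<and> loaded (?W C1) \<sigma>' \<and>
      k' \<le> k + 8 * length C1)" for \<sigma>' k'
  show ?thesis unfolding read_clause_def
  proof (rule wp_While [where I = I and m = "\<lambda>\<sigma>'. reg \<sigma>' rK"], goal_cases)
    case 1
    show ?case unfolding I_def
      by (intro exI [of _ "[]"] exI [of _ C]) (use W K inp in simp)
  next
    case (2 \<sigma>2 k2)
    have f: "reg \<sigma>2 rZ = 0" "reg \<sigma>2 rC = reg \<sigma> rC" using 2(2) rZ by (auto simp: frame_def)
    then obtain C1 l C2 where C: "C = C1 @ l # C2" "reg \<sigma>2 rK = Suc (length C2)"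
      "inp \<sigma>2 = sign l # var l # concat (map encode_literal C2) @ rest" "loaded (?W C1) \<sigma>2"
      "k2 \<le> k + 8 * length C1"
      using 2(1,3) unfolding I_def
      by (elim exE conjE) (auto simp: encode_literal_eq neq_Nil_conv)
    define \<sigma>3 where "\<sigma>3 = set_reg rP (Suc (reg \<sigma>2 rP)) (set_arr aCL (reg \<sigma>2 rP) (reg \<sigma> rC)
      (set_arr aVR (reg \<sigma>2 rP) (var l) (set_arr aSG (reg \<sigma>2 rP) (sign l)
        (set_reg rV (var l) (set_reg rS (sign l) (set_reg rK (length C2) \<sigma>2)
          \<lparr>inp := var l # concat (map encode_literal C2) @ rest\<rparr>)
          \<lparr>inp := concat (map encode_literal C2) @ rest\<rparr>))))"
    have "loaded (?W (C1 @ [l])) \<sigma>3"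
      using C(4) by (auto simp: loaded_def \<sigma>3_def nth_append nth_Cons')
    then have "I \<sigma>3 (k2 + 8)"
      unfolding I_def using C(1,5) by (intro exI [of _ "C1 @ [l]"] exI [of _ C2]) (simp add: \<sigma>3_def)
    then show ?case using C(2,3) f by (simp add: \<sigma>3_def eval_nat_numeral)
  next
    case (3 \<sigma>2 k2)
    have "reg \<sigma>2 rZ = 0" using 3(2) rZ by (auto simp: frame_def)
    then show ?case using 3(1,3) unfolding I_def by auto
  qed
qed

lemma wp_read_formula:
  assumes "\<sigma> = initial (encode_formula n \<phi>)"
  shows "wp read_formula (\<lambda>\<sigma>' k'. loaded (layout 1 \<phi>) \<sigma>' \<and> reg \<sigma>' rN = n \<and>
      k' \<le> k + 10 + 10 * formula_length \<phi>) \<sigma> k"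
proof -
  define I where "I \<sigma>' k' \<longleftrightarrow> (\<exists>\<phi>1 \<phi>2. \<phi> = \<phi>1 @ \<phi>2 \<and> reg \<sigma>' rM = length \<phi>2 \<and>
      inp \<sigma>' = concat (map encode_clause \<phi>2) \<and> loaded (layout 1 \<phi>1) \<sigma>' \<and>
      k' \<le> k + 3 + 10 * formula_length \<phi>1)" for \<sigma>' k'
  define \<sigma>1 where "\<sigma>1 = set_reg rP (Suc 0) (set_reg rM (length \<phi>) (set_reg rN n \<sigma>
    \<lparr>inp := length \<phi> # concat (map encode_clause \<phi>)\<rparr>)\<lparr>inp := concat (map encode_clause \<phi>)\<rparr>)"
  have "wp (While (Less rZ rM) (Dec rM ;; Read rK ;; Copy rC rP ;; read_clause))
    (\<lambda>\<sigma>' k'. loaded (layout 1 \<phi>) \<sigma>' \<and> reg \<sigma>' rN = n \<and> k' \<le> k + 10 + 10 * formula_length \<phi>)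
    \<sigma>1 (Suc (Suc (Suc k)))"
  proof (rule wp_While [where I = I and m = "\<lambda>\<sigma>'. reg \<sigma>' rM"], goal_cases)
    case 1
    show ?case unfolding I_def
      by (intro exI [of _ "[]"] exI [of _ \<phi>]) (simp add: \<sigma>1_def assms initial_def loaded_def)
  next
    case (2 \<sigma>2 k2)
    have f: "reg \<sigma>2 rZ = 0" using 2(2) by (auto simp: frame_def \<sigma>1_def assms initial_def)
    then obtain \<phi>1 C \<phi>2 where C: "\<phi> = \<phi>1 @ C # \<phi>2" "reg \<sigma>2 rM = Suc (length \<phi>2)"
      "inp \<sigma>2 = length C # concat (map encode_literal C) @ concat (map encode_clause \<phi>2)"
      "loaded (layout 1 \<phi>1) \<sigma>2" "k2 \<le> k + 3 + 10 * formula_length \<phi>1"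
      using 2(1,3) unfolding I_def
      by (elim exE conjE) (auto simp: encode_clause_def neq_Nil_conv)
    define \<sigma>3 where "\<sigma>3 = set_reg rC (reg \<sigma>2 rP) (set_reg rK (length C) (set_reg rM (length \<phi>2) \<sigma>2)
      \<lparr>inp := concat (map encode_literal C) @ concat (map encode_clause \<phi>2)\<rparr>)"
    have l3: "loaded (layout 1 \<phi>1) \<sigma>3" using C(4) by (simp add: loaded_def \<sigma>3_def)
    have "wp read_clause (\<lambda>\<sigma>' k'. I \<sigma>' k' \<and> reg \<sigma>' rM < reg \<sigma>2 rM) \<sigma>3 (Suc (Suc (Suc (Suc k2))))"
    proof (rule wp_conseq [OF wp_read_clause [OF l3, where C = C and rest = "concat (map encode_clause \<phi>2)"]],
        goal_cases)
      case (4 \<sigma>4 k4)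
      have P: "reg \<sigma>3 rC = 1 + length (layout 1 \<phi>1)" using C(4) by (simp add: \<sigma>3_def loaded_def)
      have "layout 1 (\<phi>1 @ [C]) = layout 1 \<phi>1 @ map (\<lambda>l. (l, reg \<sigma>3 rC)) C"
        unfolding P layout_append by simp
      then have "loaded (layout 1 (\<phi>1 @ [C])) \<sigma>4" using 4(1) by simp
      \<comment> \<open>Four steps precede \<open>read_clause\<close>, which takes at most
        \<open>1 + 8 * length C\<close>. The unit that \<open>formula_length\<close> grants to each
        clause covers the constant part.\<close>
      moreover have "k4 \<le> k + 3 + 10 * formula_length (\<phi>1 @ [C])"
        using 4(1) C(5) by (simp add: formula_length_def)
      moreover have "reg \<sigma>4 rM = length \<phi>2" using 4(2) by (auto simp: frame_def \<sigma>3_def)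
      ultimately show ?case
        using 4(1) C(1,2) unfolding I_def
        by (intro conjI exI [of _ "\<phi>1 @ [C]"] exI [of _ \<phi>2]) auto
    qed (use f in \<open>simp_all add: \<sigma>3_def\<close>)
    then show ?case using C(2,3) by (simp add: \<sigma>3_def)
  next
    case (3 \<sigma>2 k2)
    have "reg \<sigma>2 rZ = 0" "reg \<sigma>2 rN = n" using 3(2) by (auto simp: frame_def \<sigma>1_def assms initial_def)
    then show ?case using 3(1,3) unfolding I_def by auto
  qed
  then show ?thesis
    by (simp add: read_formula_def \<sigma>1_def assms initial_def encode_formula_def)
qed

lemma wp_fill_tables:
  assumes N: "reg \<sigma> rN = n"
  shows "wp fill_tables (\<lambda>\<sigma>' k'. reg \<sigma>' rN1 = n + 1 \<and>
      (\<forall>v\<le>n. arr \<sigma>' aTN v = 2 * v \<and> arr \<sigma>' aTP v = 2 * v + 1 \<and>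
        arr \<sigma>' aCMP (2 * v) = 2 * v + 1 \<and> arr \<sigma>' aCMP (2 * v + 1) = 2 * v) \<and>
      k' \<le> k + 15 + 10 * n) \<sigma> k"
proof -
  define I where "I \<sigma>' k' \<longleftrightarrow> reg \<sigma>' rV \<le> n + 1 \<and> reg \<sigma>' rX = 2 * reg \<sigma>' rV \<and>
      (\<forall>v<reg \<sigma>' rV. arr \<sigma>' aTN v = 2 * v \<and> arr \<sigma>' aTP v = 2 * v + 1 \<and>
        arr \<sigma>' aCMP (2 * v) = 2 * v + 1 \<and> arr \<sigma>' aCMP (2 * v + 1) = 2 * v) \<and>
      k' \<le> k + 4 + 10 * reg \<sigma>' rV" for \<sigma>' :: state and k'
  define \<sigma>1 where "\<sigma>1 = set_reg rX 0 (set_reg rV 0 (set_reg rN1 (Suc n) (set_reg rN1 n \<sigma>)))"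
  have "wp (While (Less rV rN1)
      (Store aTN rV rX ;; Copy rY rX ;; Inc rY ;; Store aTP rV rY ;; Store aCMP rX rY ;;
       Store aCMP rY rX ;; Inc rY ;; Copy rX rY ;; Inc rV))
    (\<lambda>\<sigma>' k'. reg \<sigma>' rN1 = n + 1 \<and>
      (\<forall>v\<le>n. arr \<sigma>' aTN v = 2 * v \<and> arr \<sigma>' aTP v = 2 * v + 1 \<and>
        arr \<sigma>' aCMP (2 * v) = 2 * v + 1 \<and> arr \<sigma>' aCMP (2 * v + 1) = 2 * v) \<and>
      k' \<le> k + 15 + 10 * n) \<sigma>1 (Suc (Suc (Suc (Suc k))))"
  proof (rule wp_While [where I = I and m = "\<lambda>\<sigma>'. n + 1 - reg \<sigma>' rV"], goal_cases)
    case 1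
    show ?case by (simp add: I_def \<sigma>1_def)
  next
    case (2 \<sigma>2 k2)
    have "reg \<sigma>2 rN1 = n + 1" using 2(2) by (auto simp: frame_def \<sigma>1_def)
    then have "reg \<sigma>2 rV < n + 1" using 2(3) by simp
    \<comment> \<open>By parity, the two new entries of \<open>aCMP\<close> do not overwrite those
      of smaller variables.\<close>
    moreover have "2 * reg \<sigma>2 rV \<noteq> Suc (2 * v)" "Suc (2 * reg \<sigma>2 rV) \<noteq> 2 * v" for v by presburger+
    ultimately show ?case using 2(1) by (auto simp: I_def less_Suc_eq)
  next
    case (3 \<sigma>2 k2)
    have "reg \<sigma>2 rN1 = n + 1" using 3(2) by (auto simp: frame_def \<sigma>1_def)
    moreover from this have "reg \<sigma>2 rV = n + 1" using 3(1,3) by (simp add: I_def)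
    ultimately show ?case using 3(1) by (auto simp: I_def)
  qed
  then show ?thesis using N by (simp add: fill_tables_def \<sigma>1_def)
qed

lemma last_occ_cong:
  "(\<And>i. i \<in> {1..j} \<Longrightarrow> f i = g i) \<Longrightarrow> last_occ f x j = last_occ g x j"
  by (induction j) auto

lemma wp_link:
  assumes P: "reg \<sigma> rP = L + 1" and Z: "reg \<sigma> rZ = 0" and head: "arr \<sigma> aHD = (\<lambda>_. 0)"
    and f: "\<And>j. j \<in> {1..L} \<Longrightarrow>
      f j = (if arr \<sigma> aSG j = 0 then arr \<sigma> aTN (arr \<sigma> aVR j) else arr \<sigma> aTP (arr \<sigma> aVR j))"
  shows "wp link (\<lambda>\<sigma>' k'. (\<forall>j\<in>{1..L}. arr \<sigma>' aLIT j = f j \<and> arr \<sigma>' aNX j = last_occ f (f j) (j - 1)) \<and>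
      arr \<sigma>' aHD = (\<lambda>x. last_occ f x L) \<and> k' \<le> k + 15 + 12 * L) \<sigma> k"
proof -
  define I where "I \<sigma>' k' \<longleftrightarrow> 1 \<le> reg \<sigma>' rJ \<and> reg \<sigma>' rJ \<le> L + 1 \<and>
      (\<forall>j\<in>{1..<reg \<sigma>' rJ}. arr \<sigma>' aLIT j = f j \<and> arr \<sigma>' aNX j = last_occ f (f j) (j - 1)) \<and>
      arr \<sigma>' aHD = (\<lambda>x. last_occ f x (reg \<sigma>' rJ - 1)) \<and>
      k' \<le> k + 1 + 12 * (reg \<sigma>' rJ - 1)" for \<sigma>' :: state and k'
  have "wp (While (Less rJ rP)
      (Load rS aSG rJ ;; Load rV aVR rJ ;; If (Eq rS rZ) (Load rX aTN rV) (Load rX aTP rV) ;;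
       Store aLIT rJ rX ;; Load rT aHD rX ;; Store aNX rJ rT ;; Store aHD rX rJ ;; Inc rJ))
    (\<lambda>\<sigma>' k'. (\<forall>j\<in>{1..L}. arr \<sigma>' aLIT j = f j \<and> arr \<sigma>' aNX j = last_occ f (f j) (j - 1)) \<and>
      arr \<sigma>' aHD = (\<lambda>x. last_occ f x L) \<and> k' \<le> k + 15 + 12 * L) (set_reg rJ 1 \<sigma>) (k + 1)"
  proof (rule wp_While [where I = I and m = "\<lambda>\<sigma>'. L + 1 - reg \<sigma>' rJ"], goal_cases)
    case 1
    show ?case using head by (simp add: I_def)
  next
    case (2 \<sigma>2 k2)
    define j where "j = reg \<sigma>2 rJ"
    have fr: "reg \<sigma>2 rP = L + 1" "reg \<sigma>2 rZ = 0" "arr \<sigma>2 aSG = arr \<sigma> aSG" "arr \<sigma>2 aVR = arr \<sigma> aVR"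
      "arr \<sigma>2 aTN = arr \<sigma> aTN" "arr \<sigma>2 aTP = arr \<sigma> aTP"
      using 2(2) P Z by (auto simp: frame_def)
    have j: "1 \<le> j" "j \<le> L" using 2(1,3) fr by (auto simp: I_def j_def)
    then obtain i where i: "j = Suc i" by (cases j) auto
    have fj: "f j = (if arr \<sigma> aSG j = 0 then arr \<sigma> aTN (arr \<sigma> aVR j) else arr \<sigma> aTP (arr \<sigma> aVR j))"
      using f j by simp
    have "(\<lambda>x. last_occ f x i)(f j := j) = (\<lambda>x. last_occ f x j)"
      by (auto simp: i fun_eq_iff)
    then show ?case
      using 2(1) fr j fj[symmetric]
      by (auto simp: I_def j_def[symmetric] i less_Suc_eq split: if_splits)
  next
    case (3 \<sigma>2 k2)
    have "reg \<sigma>2 rP = L + 1" using 3(2) P by (auto simp: frame_def)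
    then have "reg \<sigma>2 rJ = L + 1" using 3(1,3) by (simp add: I_def)
    then show ?case using 3(1) by (auto simp: I_def)
  qed
  then show ?thesis by (simp add: link_def)
qed

section \<open>The implication graph of a formula and its consistent closed sets\<close>

locale formula_graph = literal_occurrences +
  fixes \<phi> :: "nat formula"
  assumes cnf: "cnf_over {1..n} \<phi>"
    and L_eq: "L = length (layout 1 \<phi>)"
    and lit_eq: "j \<in> {1..L} \<Longrightarrow> lit j = code (fst (layout 1 \<phi> ! (j - 1)))"
    and cl_eq: "j \<in> {1..L} \<Longrightarrow> cl j = snd (layout 1 \<phi> ! (j - 1))"
begin

lemma var_bound: "C \<in> set \<phi> \<Longrightarrow> l \<in> set C \<Longrightarrow> var l \<in> {1..n}"
  using cnf unfolding cnf_over_def clause_vars_def by blast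

lemma code_N: "code l \<in> N \<longleftrightarrow> var l \<in> {1..n}"
  unfolding N_eq by (cases l) auto

lemma N_code:
  assumes "x \<in> N"
  obtains l where "x = code l" "var l \<in> {1..n}"
proof
  define l where "l = (if even x then Neg (x div 2) else Pos (x div 2))"
  show "x = code l" by (simp add: l_def)
  then show "var l \<in> {1..n}" using assms code_N by blast
qed

lemma cmp_code: "var l \<in> {1..n} \<Longrightarrow> cmp (code l) = code (neg l)"
  using cmp_even cmp_odd by (cases l) auto

lemma edge:
  assumes C: "C \<in> set \<phi>" "l \<in> set C" "l' \<in> set C" "l' \<noteq> l"
  shows "(code l, code (neg l')) \<in> E"
proof -
  obtain a b where "a < length C" "b < length C" "C ! a = l" "C ! b = l'"
    using C by (auto simp: in_set_conv_nth)
  then obtain i j where ij: "i < L" "j < L" "layout 1 \<phi> ! i = (l, snd (layout 1 \<phi> ! j))"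
    "fst (layout 1 \<phi> ! j) = l'"
    using layout_clause [OF C(1), of a b 1] L_eq by auto
  then have "lit (Suc i) = code l" "lit (Suc j) = code l'" "cl (Suc i) = cl (Suc j)" "i \<noteq> j"
    using lit_eq [of "Suc i"] lit_eq [of "Suc j"] cl_eq [of "Suc i"] cl_eq [of "Suc j"] C(4) by auto
  then have "(code l, cmp (code l')) \<in> E"
    using E_I [of "Suc i" "Suc j"] ij by simp
  then show ?thesis using cmp_code var_bound C by metis
qed

lemma edgeE:
  assumes "(x, y) \<in> E"
  obtains C l l' where "C \<in> set \<phi>" "l \<in> set C" "l' \<in> set C" "l' \<noteq> l" "x = code l" "y = code (neg l')"
proof -
  obtain i j where ij: "i \<in> {1..L}" "j \<in> {1..L}" "i \<noteq> j" "cl i = cl j" "x = lit i" "y = cmp (lit j)"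
    using assms unfolding E_def by blast
  have "i - 1 < length (layout 1 \<phi>)" "j - 1 < length (layout 1 \<phi>)" "i - 1 \<noteq> j - 1"
    using ij(1-3) L_eq by auto
  moreover have "snd (layout 1 \<phi> ! (i - 1)) = snd (layout 1 \<phi> ! (j - 1))"
    using cl_eq ij(1,2,4) by metis
  ultimately obtain C a b where C: "C \<in> set \<phi>" "a < length C" "b < length C"
    "fst (layout 1 \<phi> ! (i - 1)) = C ! a" "fst (layout 1 \<phi> ! (j - 1)) = C ! b"
    using layout_same_clause by metis
  have lits: "lit i = code (C ! a)" "lit j = code (C ! b)" using lit_eq ij(1,2) C by metis+
  then have "C ! b \<noteq> C ! a" using lit_distinct [OF ij(1-4)] by auto
  moreover have "y = code (neg (C ! b))" using ij lits cmp_code var_bound C by (metis nth_mem)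
  ultimately show ?thesis using that C lits ij(5) nth_mem by metis
qed

lemma partially_horn_of_found:
  assumes x: "x \<in> N" "cmp x \<notin> reach x"
  shows "partially_horn {1..n} (rename {v \<in> {1..n}. 2 * v \<in> reach x} \<phi>)"
proof -
  define A where "A = {l. code l \<in> reach x}"
  have var_A: "var l \<in> {1..n}" if "l \<in> A" for l
    using that reach_N [OF x(1)] code_N unfolding A_def by blast
  have "neg l \<notin> A" if "l \<in> A" for l
    using reach_consistent [OF x, of "code l"] cmp_code [OF var_A [OF that]] that by (simp add: A_def)
  moreover have "neg l' \<in> A" if "C \<in> set \<phi>" "l \<in> set C" "l' \<in> set C" "l \<in> A" "l' \<noteq> l" for C l l'
    using edge that reach_step unfolding A_def by blast
  moreover have "A \<noteq> {}"
    using x(1) reach_refl [of x] by (auto simp: A_def elim!: N_code)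
  ultimately have "horn_closed \<phi> A" unfolding horn_closed_def by blast
  then have "partially_horn {1..n} (rename {v. Neg v \<in> A} \<phi>)"
    using var_A by (intro horn_closed_partially_horn) auto
  moreover have "{v. Neg v \<in> A} = {v \<in> {1..n}. 2 * v \<in> reach x}"
    using var_A [of "Neg _"] by (auto simp: A_def)
  ultimately show ?thesis by simp
qed

text \<open>A consistent closed set with a literal \<open>l\<close> contains everything reachable
  from \<open>l\<close>, in particular the complement of \<open>l\<close>.\<close>

lemma not_renamable:
  assumes "\<forall>x\<in>N. cmp x \<in> reach x"
  shows "\<not> renamable_partially_horn {1..n} \<phi>"
proof
  assume "renamable_partially_horn {1..n} \<phi>"
  then obtain A where A: "horn_closed \<phi> A" "var ` A \<subseteq> {1..n}"
    using partially_horn_horn_closed [of "{1..n}" _ \<phi>] cnf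
    unfolding renamable_partially_horn_def cnf_over_def by blast
  then obtain l where "l \<in> A" unfolding horn_closed_def by blast
  then have l: "l \<in> A" "var l \<in> {1..n}" using A(2) by blast+
  have "reach (code l) \<subseteq> code ` A"
  proof (rule reach_least)
    fix y z assume yz: "y \<in> code ` A" "(y, z) \<in> E"
    from yz(2) obtain C l1 l2 where "C \<in> set \<phi>" "l1 \<in> set C" "l2 \<in> set C" "l2 \<noteq> l1"
      "y = code l1" "z = code (neg l2)" by (rule edgeE)
    moreover from this yz(1) have "l1 \<in> A" by auto
    ultimately show "z \<in> code ` A" using A(1) unfolding horn_closed_def by blast
  qed (use l in auto)
  moreover have "code (neg l) \<in> reach (code l)"
    using assms l(2) code_N cmp_code by metis
  ultimately have "neg l \<in> A" by auto
  then show False using A(1) l(1) unfolding horn_closed_def by blast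
qed

end

lemma layout_fst: "p \<in> set (layout s \<phi>) \<Longrightarrow> \<exists>C\<in>set \<phi>. fst p \<in> set C"
  by (induction \<phi> arbitrary: s) auto

lemma layout_formula_graph:
  fixes \<phi> :: "nat formula" and lit cl cmp head nx :: "nat \<Rightarrow> nat"
  assumes cnf: "cnf_over {1..n} \<phi>" and L: "L = length (layout 1 \<phi>)"
    and lit: "\<And>j. j \<in> {1..L} \<Longrightarrow> lit j = code (fst (layout 1 \<phi> ! (j - 1)))"
    and cl: "\<And>j. cl j = (if j \<in> {1..L} then snd (layout 1 \<phi> ! (j - 1)) else 0)"
    and cmp: "\<And>v. v \<le> n \<Longrightarrow> cmp (2 * v) = 2 * v + 1 \<and> cmp (2 * v + 1) = 2 * v"
    and head: "\<And>x. head x = last_occ lit x L"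
    and nx: "\<And>j. j \<in> {1..L} \<Longrightarrow> nx j = last_occ lit (lit j) (j - 1)"
  shows "formula_graph L lit cl cmp head nx {2..2 * n + 1} n \<phi>"
proof -
  let ?W = "layout 1 \<phi>"
  have cases_N: "\<exists>v\<in>{1..n}. x = 2 * v \<or> x = 2 * v + 1" if "x \<in> {2..2 * n + 1}" for x
    using that by (intro bexI [of _ "x div 2"]) auto
  have idx: "j - 1 < length ?W" if "j \<in> {1..L}" for j using that L by auto
  have cl': "cl j = snd (?W ! (j - 1))" if "j \<in> {1..L}" for j using cl that by simp
  have clb: "1 \<le> cl j \<and> cl j \<le> j" if "j \<in> {1..L}" for j
    using layout_bounds [OF idx [OF that]] cl' [OF that] that by auto
  have same: "\<exists>C\<in>set \<phi>. \<exists>a<length C. \<exists>b<length C. a \<noteq> b \<and> fst (?W ! (i - 1)) = C ! a \<and> fst (?W ! (j - 1)) = C ! b"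
    if "i \<in> {1..L}" "j \<in> {1..L}" "i \<noteq> j" "cl i = cl j" for i j
    using that cl' [of i] cl' [of j] by (intro layout_same_clause idx) auto
  show ?thesis
  proof (unfold_locales, goal_cases)
    case (2 x)
    then show ?case using cases_N [of x] cmp by auto
  next
    case (3 x)
    then show ?case using cases_N [of x] cmp by auto
  next
    case (4 j)
    obtain C where C: "C \<in> set \<phi>" "fst (?W ! (j - 1)) \<in> set C"
      using layout_fst [OF nth_mem [OF idx [OF 4]]] by blast
    then have "var (fst (?W ! (j - 1))) \<in> {1..n}"
      using cnf unfolding cnf_over_def clause_vars_def by blast
    then show ?case using lit [OF 4] by (cases "fst (?W ! (j - 1))") auto
  next
    case (7 j)
    have "cl j \<in> {1..L}" using clb [OF 7] 7 by auto
    then show ?case using layout_start [OF idx [OF 7]] cl' 7 by simp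
  next
    case (8 i j)
    then show ?case using layout_mono [of "i - 1" "j - 1" 1 \<phi>] cl' idx [of j] by auto
  next
    case (10 i j)
    then obtain C a b where C: "C \<in> set \<phi>" "a < length C" "b < length C" "a \<noteq> b"
      "fst (?W ! (i - 1)) = C ! a" "fst (?W ! (j - 1)) = C ! b" using same by blast
    moreover have "distinct C" using cnf C(1) unfolding cnf_over_def by (auto simp: distinct_map)
    ultimately show ?case using lit 10 by (simp add: nth_eq_iff_index_eq)
  next
    case (5 j)
    then show ?case using clb by blast
  next
    case (6 j)
    then show ?case using clb by blast
  next
    case 9
    show ?case using cl by simp
  next
    case (11 x)
    show ?case using head by blast
  next
    case (12 j)
    then show ?case using nx by blast
  next
    case (14 v)
    then show ?case using cmp by simp
  next
    case (15 v)
    then show ?case using cmp by simp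
  next
    case (18 j)
    then show ?case using lit by blast
  next
    case (19 j)
    then show ?case using cl' by blast
  qed (use cnf L in simp_all)
qed

section \<open>Composition of the stages and the total running time\<close>

lemma main_correct:
  assumes cnf: "cnf_over {1..n} \<phi>"
  shows "wp main (\<lambda>\<sigma> k. k \<le> 1000 * (formula_length \<phi> + 1) \<and>
    (out \<sigma> = [0] \<and> \<not> renamable_partially_horn {1..n} \<phi> \<or>
      (\<exists>xs. out \<sigma> = 1 # xs \<and> set xs \<subseteq> {1..n} \<and> partially_horn {1..n} (rename (set xs) \<phi>))))
    (initial (encode_formula n \<phi>)) 0"
    (is "wp _ ?Q ?\<sigma>0 0")
proof -
  define L where "L = length (layout 1 \<phi>)"
  have len: "L \<le> formula_length \<phi>" using length_layout [of 1 \<phi>] by (simp add: L_def)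
  show ?thesis
    unfolding main_def wp_Seq
  proof (rule wp_conseq [OF wp_read_formula [OF refl]], goal_cases)
    case (1 \<sigma>1 k1)
    then have W: "loaded (layout 1 \<phi>) \<sigma>1" and N: "reg \<sigma>1 rN = n"
      and k1: "k1 \<le> 10 + 10 * formula_length \<phi>" by auto
    have f1: "\<And>r. r \<notin> {rN, rM, rP, rC, rK, rS, rV} \<Longrightarrow> reg \<sigma>1 r = 0"
      "\<And>a. a \<notin> {aSG, aVR, aCL} \<Longrightarrow> arr \<sigma>1 a = (\<lambda>_. 0)" "out \<sigma>1 = []"
      using 1(2) by (auto simp: frame_def initial_def)
    have P: "reg \<sigma>1 rP = L + 1" using W by (simp add: loaded_def L_def)
    show ?case
    proof (cases "n \<le> L")
      case False
      then have "partially_horn {1..n} (rename {} \<phi>)"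
        by (intro partially_horn_unused_variable) (simp add: L_def)
      then show ?thesis using False N P k1 f1(3) by simp
    next
      case True
      have "wp fill_tables (wp (link ;; search ;; report) ?Q) \<sigma>1 (k1 + 1)"
      proof (rule wp_conseq [OF wp_fill_tables [OF N]], goal_cases)
        case (1 \<sigma>2 k2)
        have k2: "k2 \<le> k1 + 1 + 15 + 10 * n" using 1(1) by blast
        let ?f = "\<lambda>j. code (fst (layout 1 \<phi> ! (j - 1)))"
        have f2: "reg \<sigma>2 rP = L + 1" "reg \<sigma>2 rZ = 0" "arr \<sigma>2 aHD = (\<lambda>_. 0)"
          "arr \<sigma>2 aM = (\<lambda>_. 0)" "arr \<sigma>2 aCM = (\<lambda>_. 0)" "reg \<sigma>2 rF = 0" "out \<sigma>2 = []"
          "arr \<sigma>2 aSG = arr \<sigma>1 aSG" "arr \<sigma>2 aVR = arr \<sigma>1 aVR" "arr \<sigma>2 aCL = arr \<sigma>1 aCL"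
          using 1(2) f1 P by (auto simp: frame_def)
        have lit: "?f j = (if arr \<sigma>2 aSG j = 0 then arr \<sigma>2 aTN (arr \<sigma>2 aVR j)
            else arr \<sigma>2 aTP (arr \<sigma>2 aVR j))" if j: "j \<in> {1..L}" for j
        proof -
          let ?l = "fst (layout 1 \<phi> ! (j - 1))"
          have "layout 1 \<phi> ! (j - 1) \<in> set (layout 1 \<phi>)" using j by (intro nth_mem) (auto simp: L_def)
          then obtain C where "C \<in> set \<phi>" "?l \<in> set C" using layout_fst by blast
          then have "var ?l \<in> {1..n}" using cnf unfolding cnf_over_def clause_vars_def by blast
          moreover have "arr \<sigma>1 aSG j = sign ?l" "arr \<sigma>1 aVR j = var ?l"
            using W j by (auto simp: loaded_def L_def)
          ultimately show ?thesis using 1(1) f2 by (cases ?l) auto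
        qed
        show ?case unfolding wp_Seq
        proof (rule wp_conseq [OF wp_link [where f = ?f, OF f2(1-3) lit]], goal_cases)
          case (2 \<sigma>3 k3)
          have k3: "k3 \<le> k2 + 15 + 12 * L" using 2(1) by blast
          have f3: "reg \<sigma>3 rZ = 0" "arr \<sigma>3 aM = (\<lambda>_. 0)" "arr \<sigma>3 aCM = (\<lambda>_. 0)" "reg \<sigma>3 rF = 0"
            "out \<sigma>3 = []" "arr \<sigma>3 aCL = arr \<sigma>1 aCL" "arr \<sigma>3 aCMP = arr \<sigma>2 aCMP"
            "arr \<sigma>3 aTN = arr \<sigma>2 aTN" "arr \<sigma>3 aTP = arr \<sigma>2 aTP" "reg \<sigma>3 rN1 = n + 1"
            using 2(2) f2 1(1) by (auto simp: frame_def)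
          have lits: "arr \<sigma>3 aLIT j = ?f j" if "j \<in> {1..L}" for j using 2(1) that by blast
          \<comment> \<open>The array is known to agree with \<open>?f\<close> only on positions 1
            to \<open>L\<close>, and \<open>last_occ\<close> looks at no others.\<close>
          have occ: "last_occ ?f x j = last_occ (arr \<sigma>3 aLIT) x j" if "j \<le> L" for x j
            using lits that by (intro last_occ_cong) auto
          interpret formula_graph L "arr \<sigma>3 aLIT" "arr \<sigma>3 aCL" "arr \<sigma>3 aCMP" "arr \<sigma>3 aHD"
            "arr \<sigma>3 aNX" "{2..2 * n + 1}" n \<phi>
          proof (rule layout_formula_graph [OF cnf L_def])
            fix j show "arr \<sigma>3 aCL j = (if j \<in> {1..L} then snd (layout 1 \<phi> ! (j - 1)) else 0)"
              using W unfolding f3 by (simp add: loaded_def L_def)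
          next
            fix v assume "v \<le> n"
            then show "arr \<sigma>3 aCMP (2 * v) = 2 * v + 1 \<and> arr \<sigma>3 aCMP (2 * v + 1) = 2 * v"
              using 1(1) unfolding f3 by blast
          next
            fix x show "arr \<sigma>3 aHD x = last_occ (arr \<sigma>3 aLIT) x L"
              using 2(1) occ by auto
          next
            fix j assume j: "j \<in> {1..L}"
            then have "arr \<sigma>3 aNX j = last_occ ?f (?f j) (j - 1)" using 2(1) by blast
            then show "arr \<sigma>3 aNX j = last_occ (arr \<sigma>3 aLIT) (arr \<sigma>3 aLIT j) (j - 1)"
              using occ [of "j - 1"] lits [OF j] j by auto
          qed (rule lits)
          have d3: "data \<sigma>3" unfolding data_def using f3(1) by simp
          have t3: "table \<sigma>3" using 1(1) f3 by (simp add: table_def)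
          have "card {i \<in> {1..L}. arr \<sigma>3 aLIT i \<in> {2..2 * n + 1}} \<le> card {1..L}"
            by (intro card_mono) auto
          \<comment> \<open>There are \<open>2 * n\<close> literals and at most \<open>L\<close>
            occurrences; \<open>n \<le> L\<close> in this branch removes the dependence on
            \<open>n\<close>.\<close>
          then have w: "weight {2..2 * n + 1} \<le> 3 * L" using True by (simp add: weight_def)
          show ?case
          proof (rule wp_conseq [OF wp_search [OF d3 t3 f3(2,3,4)]], goal_cases)
            case (1 \<sigma>4 k4)
            have d4: "data \<sigma>4" "table \<sigma>4" "out \<sigma>4 = []"
              using 1(2) d3 t3 f3(5) by (auto simp: frame_def data_def table_def)
            have k4: "k4 \<le> k3 + 80 + 80 * n + 200 * weight {2..2 * n + 1}"
              and res: "found \<sigma>4 \<or> reg \<sigma>4 rF = 0 \<and> (\<forall>x\<in>{2..2 * n + 1}. arr \<sigma>3 aCMP x \<in> reach x)"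
              using 1(1) by auto
            have F: "found \<sigma>4 \<or> reg \<sigma>4 rF = 0" "stamped \<sigma>4" using 1(1) by auto
            show ?case
            proof (rule wp_conseq [OF wp_report [OF d4(1,2) F(2) d4(3) F(1)]], goal_cases)
              case (1 \<sigma>5 k5)
              note out5 = 1(1)
              have "k5 \<le> 1000 * (formula_length \<phi> + 1)"
              proof -
                \<comment> \<open>With \<open>n\<close> and \<open>L\<close> bounded by the length
                  and the weight by three times \<open>L\<close>, the stages add up to 10 + 10 + 12
                  + 80 + 10 plus 3 times 240, which is 842.\<close>
                have "k5 \<le> 151 + 842 * formula_length \<phi>"
                  using conjunct2 [OF out5] k4 k3 k2 k1 w len True by linarith
                also have "\<dots> \<le> 1000 * (formula_length \<phi> + 1)" by simp
                finally show ?thesis .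
              qed
              then show ?case
              proof (cases "reg \<sigma>4 rF = 0")
                case True
                then have "\<not> found \<sigma>4" unfolding found_def by simp
                then have "\<not> renamable_partially_horn {1..n} \<phi>"
                  using res by (intro not_renamable) blast
                then show ?thesis using True out5 \<open>k5 \<le> _\<close> by simp
              next
                case False
                let ?x = "reg \<sigma>4 rX" and ?xs = "filter (\<lambda>v. 2 * v \<in> reach (reg \<sigma>4 rX)) [1..<n + 1]"
                have "?x \<in> {2..2 * n + 1}" "arr \<sigma>3 aCMP ?x \<notin> reach ?x"
                  using F(1) False unfolding found_def by blast+
                then have "partially_horn {1..n} (rename {v \<in> {1..n}. 2 * v \<in> reach ?x} \<phi>)"
                  by (rule partially_horn_of_found)
                moreover have xs: "set ?xs = {v \<in> {1..n}. 2 * v \<in> reach ?x}" by auto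
                ultimately have "partially_horn {1..n} (rename (set ?xs) \<phi>)" by (simp only: xs)
                moreover have "set ?xs \<subseteq> {1..n}" unfolding xs by blast
                moreover have "out \<sigma>5 = 1 # ?xs" using conjunct1 [OF out5] False by (simp only: if_False)
                ultimately show ?thesis using \<open>k5 \<le> _\<close> by blast
              qed
            qed
          qed
        qed
      qed
      then show ?thesis using True N P by simp
    qed
  qed
qed

theorem theorem3p3:
  "\<exists>(p :: prog) (c :: nat). \<forall>(n :: nat) (\<phi> :: nat formula). cnf_over {1..n} \<phi> \<longrightarrow>
     (\<exists>t ys. runs p (encode_formula n \<phi>) t ys \<and> t \<le> c * (formula_length \<phi> + 1) \<and>
        (ys = [0] \<and> \<not> renamable_partially_horn {1..n} \<phi> \<or>
         (\<exists>xs. ys = 1 # xs \<and> set xs \<subseteq> {1..n} \<and> partially_horn {1..n} (rename (set xs) \<phi>))))"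
proof (rule exI [of _ main], rule exI [of _ 1000], intro allI impI)
  fix n and \<phi> :: "nat formula"
  assume "cnf_over {1..n} \<phi>"
  from main_correct [OF this]
  show "\<exists>t ys. runs main (encode_formula n \<phi>) t ys \<and> t \<le> 1000 * (formula_length \<phi> + 1) \<and>
        (ys = [0] \<and> \<not> renamable_partially_horn {1..n} \<phi> \<or>
         (\<exists>xs. ys = 1 # xs \<and> set xs \<subseteq> {1..n} \<and> partially_horn {1..n} (rename (set xs) \<phi>)))"
    unfolding wp_def runs_def by auto
qed

end
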